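(* Let $\mathcal H=(\mathcal H_L,\mathcal H_R,S)$ be a Hopf algebroid with a bijective antipode and let $A$ be a right $\mathcal H$-comodule algebra. Then the subalgebra of $\mathcal H_R$-coinvariants of $A$ and the subalgebra of $\mathcal H_L$-coinvariants of $A$ coincide. Moreover, denoting this coinvariant subalgebra by $B$, the canonical map $$\mathrm{can}_R: A\otimes_B A\to A\otimes_R H,\qquad a\otimes_B a'\mapsto a\,a'^{\langle 0\rangle}\otimes_R a'^{\langle 1\rangle}$$ is injective (respectively surjective, respectively bijective) if and only if the canonical map $$\mathrm{can}_L: A\otimes_B A\to A\otimes_L H,\qquad a\otimes_B a'\mapsto a_{\langle 0\rangle}a'\otimes_L a_{\langle 1\rangle}$$ is injective (respectively surjective, respectively bijective).
   Context: Conventions. $k$ is a commutative ring; "algebra" means associative unital $k$-algebra. For an algebra $R$, an $R$-ring is a monoid and an $R$-coring is a comonoid in the monoidal category of $R$-$R$ bimodules. Summation is implied in all Sweedler-type notations. Left bialgebroid $(H,L,s,t,\gamma,\pi)$: algebras $H,L$; algebra maps $s:L\to H$, $t:L^{op}\to H$ with commuting images; an $L$-coring structure $(H,\gamma,\pi)$ on the bimodule $l\cdot h\cdot l'=s(l)t(l')h$, with $\gamma(h)=h_{(1)}\otimes_L h_{(2)}$, such that $h_{(1)}t(l)\otimes_L h_{(2)}=h_{(1)}\otimes_L h_{(2)}s(l)$, $\gamma(1_H)=1_H\otimes_L 1_H$, $\gamma(hh')=\gamma(h)\gamma(h')$, $\pi(1_H)=1_L$, $\pi(h\,s(\pi(h')))=\pi(hh')=\pi(h\,t(\pi(h')))$.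 Right bialgebroid $(H,R,s,t,\gamma,\pi)$: algebras $H,R$; algebra maps $s:R\to H$, $t:R^{op}\to H$ with commuting images; an $R$-coring structure $(H,\gamma,\pi)$ on the bimodule $r\cdot h\cdot r'=h\,t(r)s(r')$, with $\gamma(h)=h^{(1)}\otimes_R h^{(2)}$, such that $s(r)h^{(1)}\otimes_R h^{(2)}=h^{(1)}\otimes_R t(r)h^{(2)}$, $\gamma(1_H)=1_H\otimes_R 1_H$, $\gamma(hh')=\gamma(h)\gamma(h')$, $\pi(1_H)=1_R$, $\pi(s(\pi(h))h')=\pi(hh')=\pi(t(\pi(h))h')$. Hopf algebroid $\mathcal H=(\mathcal H_L,\mathcal H_R,S)$: a left bialgebroid $\mathcal H_L=(H,L,s_L,t_L,\gamma_L,\pi_L)$ and a right bialgebroid $\mathcal H_R=(H,R,s_R,t_R,\gamma_R,\pi_R)$ on the same algebra $H$, and a $k$-module map $S:H\to H$ (the antipode), with $\gamma_L(h)=h_{(1)}\otimes_L h_{(2)}$, $\gamma_R(h)=h^{(1)}\otimes_R h^{(2)}$, such that (i) $s_L\pi_Lt_R=t_R$, $t_L\pi_Ls_R=s_R$, $s_R\pi_Rt_L=t_L$, $t_R\pi_Rs_L=s_L$; (ii) $(\gamma_L\otimes_R H)\gamma_R=(H\otimes_L\gamma_R)\gamma_L$ and $(\gamma_R\otimes_L H)\gamma_L=(H\otimes_R\gamma_L)\gamma_R$ (tensor products over $L$ with respect to $h\cdot l=t_L(l)h$, $l\cdot h=s_L(l)h$, and over $R$ with respect to $h\cdot r=hs_R(r)$,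 $r\cdot h=ht_R(r)$); (iii) $S(t_L(l)ht_L(l'))=s_L(l')S(h)s_L(l)$ and $S(t_R(r)ht_R(r'))=s_R(r')S(h)s_R(r)$; (iv) $S(h_{(1)})h_{(2)}=s_R(\pi_R(h))$ and $h^{(1)}S(h^{(2)})=s_L(\pi_L(h))$. Comodules and comodule algebras. A right comodule of a right bialgebroid $\mathcal H_R$ is a right comodule $(M,\tau_R)$ of the $R$-coring $(H,\gamma_R,\pi_R)$, $\tau_R(m)=m^{\langle0\rangle}\otimes_R m^{\langle1\rangle}$; it is an $R$-$R$ bimodule with left action $r\cdot m=m^{\langle0\rangle}\cdot\pi_R(s_R(r)m^{\langle1\rangle})$, and satisfies $r\cdot m^{\langle0\rangle}\otimes_R m^{\langle1\rangle}=m^{\langle0\rangle}\otimes_R t_R(r)m^{\langle1\rangle}$. A right $\mathcal H_R$-comodule algebra is an $R$-ring $A$ (with this bimodule structure) which is a right $\mathcal H_R$-comodule with $\tau_R(1_A)=1_A\otimes_R1_H$ and $\tau_R(aa')=a^{\langle0\rangle}a'^{\langle0\rangle}\otimes_R a^{\langle1\rangle}a'^{\langle1\rangle}$. A right comodule of a left bialgebroid $\mathcal H_L$ is a right comodule $(M,\tau_L)$ of the $L$-coring $(H,\gamma_L,\pi_L)$, $\tau_L(m)=m_{\langle0\rangle}\otimes_L m_{\langle1\rangle}$; it is an $L$-$L$ bimodule with left action $l\cdot m=m_{\langle0\rangle}\cdot\pi_L(m_{\langle1\rangle}s_L(l))$, and satisfies $l\cdot m_{\langle0\rangle}\otimes_L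 m_{\langle1\rangle}=m_{\langle0\rangle}\otimes_L m_{\langle1\rangle}s_L(l)$. A right $\mathcal H_L$-comodule algebra is an algebra $A$ which is a right $\mathcal H_L$-comodule and an $L^{op}$-ring, i.e. $a\cdot l=(1_A\cdot l)a$, $l\cdot a=a(1_A\cdot l)$, $l\cdot 1_A=1_A\cdot l$, with $\tau_L(1_A)=1_A\otimes_L1_H$ and $\tau_L(aa')=a_{\langle0\rangle}a'_{\langle0\rangle}\otimes_L a_{\langle1\rangle}a'_{\langle1\rangle}$. A right comodule of the Hopf algebroid $\mathcal H$ is a triple $(M,\tau_L,\tau_R)$ with $(M,\tau_R)$ a right $\mathcal H_R$-comodule and $(M,\tau_L)$ a right $\mathcal H_L$-comodule such that $l\cdot m\cdot l'=\pi_R(t_L(l'))\cdot m\cdot\pi_R(t_L(l))$ for $l,l'\in L$, and $(\tau_R\otimes_LH)\tau_L=(M\otimes_R\gamma_L)\tau_R$, $(\tau_L\otimes_RH)\tau_R=(M\otimes_L\gamma_R)\tau_L$. A right $\mathcal H$-comodule algebra is a right $\mathcal H$-comodule $(A,\tau_L,\tau_R)$ such that $A$ is an algebra, $(A,\tau_R)$ is a right $\mathcal H_R$-comodule algebra and $(A,\tau_L)$ is a right $\mathcal H_L$-comodule algebra. The $\mathcal H_R$-coinvariants of $A$ are $\{a\in A: \tau_R(a)=a\otimes_R1_H\}$; the $\mathcal H_L$-coinvariants are $\{a\in A:\tau_L(a)=a\otimes_L1_H\}$. *)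

theory Defs
  imports "HOL-Library.Poly_Mapping"
begin

section \<open>Algebras over a commutative ring\<close>

text \<open>
  Associative unital rings are types of sort \<open>{ring, monoid_mult}\<close>.  This is the class
  \<open>ring_1\<close> without the axiom \<open>0 \<noteq> 1\<close>, so the zero ring is allowed, also as the ground ring \<open>k\<close>.
\<close>

locale k_module =
  fixes scale :: "'k::{comm_ring,monoid_mult} \<Rightarrow> 'm::ab_group_add \<Rightarrow> 'm"
  assumes scale_add_right: "scale c (x + y) = scale c x + scale c y"
    and scale_add_left: "scale (c + d) x = scale c x + scale d x"
    and scale_scale: "scale c (scale d x) = scale (c * d) x"
    and scale_one: "scale 1 x = x"

locale k_algebra = k_module scale
  for scale :: "'k::{comm_ring,monoid_mult} \<Rightarrow> 'a::{ring,monoid_mult} \<Rightarrow> 'a" +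
  assumes scale_mult_left: "scale c (x * y) = scale c x * y"
    and scale_mult_right: "scale c (x * y) = x * scale c y"

definition k_linear ::
  "('k \<Rightarrow> 'm::ab_group_add \<Rightarrow> 'm) \<Rightarrow> ('k \<Rightarrow> 'n::ab_group_add \<Rightarrow> 'n) \<Rightarrow> ('m \<Rightarrow> 'n) \<Rightarrow> bool"
  where "k_linear kM kN f \<longleftrightarrow>
    (\<forall>x y. f (x + y) = f x + f y) \<and> (\<forall>c x. f (kM c x) = kN c (f x))"

definition algebra_map ::
  "('k \<Rightarrow> 'a::{ring,monoid_mult} \<Rightarrow> 'a) \<Rightarrow> ('k \<Rightarrow> 'b::{ring,monoid_mult} \<Rightarrow> 'b) \<Rightarrow> ('a \<Rightarrow> 'b) \<Rightarrow> bool"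
  where "algebra_map kA kB f \<longleftrightarrow>
    k_linear kA kB f \<and> f 1 = 1 \<and> (\<forall>x y. f (x * y) = f x * f y)"

text \<open>An algebra map from the opposite algebra \<open>A\<^sup>o\<^sup>p\<close> to \<open>B\<close>.\<close>

definition op_algebra_map ::
  "('k \<Rightarrow> 'a::{ring,monoid_mult} \<Rightarrow> 'a) \<Rightarrow> ('k \<Rightarrow> 'b::{ring,monoid_mult} \<Rightarrow> 'b) \<Rightarrow> ('a \<Rightarrow> 'b) \<Rightarrow> bool"
  where "op_algebra_map kA kB f \<longleftrightarrow>
    k_linear kA kB f \<and> f 1 = 1 \<and> (\<forall>x y. f (x * y) = f y * f x)"

definition right_module ::
  "('k \<Rightarrow> 'r::{ring,monoid_mult} \<Rightarrow> 'r) \<Rightarrow> ('k \<Rightarrow> 'm::ab_group_add \<Rightarrow> 'm) \<Rightarrow> ('m \<Rightarrow> 'r \<Rightarrow> 'm) \<Rightarrow> bool"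
  where "right_module kR kM act \<longleftrightarrow>
    (\<forall>m m' r. act (m + m') r = act m r + act m' r) \<and>
    (\<forall>m r r'. act m (r + r') = act m r + act m r') \<and>
    (\<forall>m r r'. act m (r * r') = act (act m r) r') \<and>
    (\<forall>m. act m 1 = m) \<and>
    (\<forall>c m r. act m (kR c r) = kM c (act m r)) \<and>
    (\<forall>c m r. act (kM c m) r = kM c (act m r))"

definition left_module ::
  "('k \<Rightarrow> 'r::{ring,monoid_mult} \<Rightarrow> 'r) \<Rightarrow> ('k \<Rightarrow> 'm::ab_group_add \<Rightarrow> 'm) \<Rightarrow> ('r \<Rightarrow> 'm \<Rightarrow> 'm) \<Rightarrow> bool"
  where "left_module kR kM lact \<longleftrightarrow>
    (\<forall>m m' r. lact r (m + m') = lact r m + lact r m') \<and>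
    (\<forall>m r r'. lact (r + r') m = lact r m + lact r' m) \<and>
    (\<forall>m r r'. lact (r * r') m = lact r (lact r' m)) \<and>
    (\<forall>m. lact 1 m = m) \<and>
    (\<forall>c m r. lact (kR c r) m = kM c (lact r m)) \<and>
    (\<forall>c m r. lact r (kM c m) = kM c (lact r m))"

definition bimodule ::
  "('k \<Rightarrow> 'r::{ring,monoid_mult} \<Rightarrow> 'r) \<Rightarrow> ('k \<Rightarrow> 'm::ab_group_add \<Rightarrow> 'm)
    \<Rightarrow> ('r \<Rightarrow> 'm \<Rightarrow> 'm) \<Rightarrow> ('m \<Rightarrow> 'r \<Rightarrow> 'm) \<Rightarrow> bool"
  where "bimodule kR kM lact act \<longleftrightarrow>
    left_module kR kM lact \<and> right_module kR kM act \<and>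
    (\<forall>r m r'. act (lact r m) r' = lact r (act m r'))"


section \<open>Tensor products\<close>

text \<open>
  The tensor product \<open>M \<otimes>\<^sub>R N\<close> is the free abelian group on \<open>M \<times> N\<close> modulo biadditivity and
  \<open>(m \<cdot> r, n) = (m, r \<cdot> n)\<close>.  Its elements are equivalence classes of type \<open>('m, 'n) tensor\<close>;
  the set of all of them is \<open>tensor_product Q\<close>, where \<open>Q\<close> is the set of pairs of pure tensors
  identified by the middle action.  The scalars form a set \<open>R\<close>, so that \<open>R\<close> may be a subring.
  Since \<open>R\<close> is a \<open>k\<close>-algebra, \<open>k\<close>-balancedness needs no separate relation.
\<close>

type_synonym ('m, 'n) tensor = "('m \<times> 'n \<Rightarrow>\<^sub>0 int) set"
type_synonym ('m, 'n, 'p) tensor3 = "('m \<times> 'n \<times> 'p \<Rightarrow>\<^sub>0 int) set"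

inductive_set additive_span :: "'x::ab_group_add set \<Rightarrow> 'x set" for G where
  zero: "0 \<in> additive_span G"
| gen: "x \<in> G \<Longrightarrow> x \<in> additive_span G"
| diff: "x \<in> additive_span G \<Longrightarrow> y \<in> additive_span G \<Longrightarrow> x - y \<in> additive_span G"

definition balance :: "'r set \<Rightarrow> ('m \<Rightarrow> 'r \<Rightarrow> 'm) \<Rightarrow> ('r \<Rightarrow> 'n \<Rightarrow> 'n) \<Rightarrow> (('m \<times> 'n) \<times> ('m \<times> 'n)) set"
  where "balance R ract lact = {((ract m r, n), (m, lact r n)) | m r n. r \<in> R}"

definition tensor_relators ::
  "(('m::ab_group_add \<times> 'n::ab_group_add) \<times> ('m \<times> 'n)) set \<Rightarrow> ('m \<times> 'n \<Rightarrow>\<^sub>0 int) set"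
  where "tensor_relators Q =
    {frag_of (m + m', n) - frag_of (m, n) - frag_of (m', n) | m m' n. True} \<union>
    {frag_of (m, n + n') - frag_of (m, n) - frag_of (m, n') | m n n'. True} \<union>
    {frag_of p - frag_of q | p q. (p, q) \<in> Q}"

definition tensor_eq ::
  "(('m::ab_group_add \<times> 'n::ab_group_add) \<times> ('m \<times> 'n)) set
    \<Rightarrow> (('m \<times> 'n \<Rightarrow>\<^sub>0 int) \<times> ('m \<times> 'n \<Rightarrow>\<^sub>0 int)) set"
  where "tensor_eq Q = {(u, v). u - v \<in> additive_span (tensor_relators Q)}"

definition tensor_product ::
  "(('m::ab_group_add \<times> 'n::ab_group_add) \<times> ('m \<times> 'n)) set \<Rightarrow> ('m, 'n) tensor set"
  where "tensor_product Q = UNIV // tensor_eq Q"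

text \<open>\<open>tens Q [(m\<^sub>1, n\<^sub>1), \<dots>, (m\<^sub>j, n\<^sub>j)]\<close> is the element \<open>m\<^sub>1 \<otimes> n\<^sub>1 + \<dots> + m\<^sub>j \<otimes> n\<^sub>j\<close>.\<close>

definition formal_sum :: "'x list \<Rightarrow> ('x \<Rightarrow>\<^sub>0 int)"
  where "formal_sum xs = (\<Sum>x\<leftarrow>xs. frag_of x)"

definition tens ::
  "(('m::ab_group_add \<times> 'n::ab_group_add) \<times> ('m \<times> 'n)) set \<Rightarrow> ('m \<times> 'n) list \<Rightarrow> ('m, 'n) tensor"
  where "tens Q xs = tensor_eq Q `` {formal_sum xs}"

text \<open>
  The threefold tensor product \<open>M \<otimes> N \<otimes> P\<close>, balanced over one ring in the first position
  (by \<open>Q\<close>) and over a possibly different one in the second (by \<open>Q'\<close>).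
\<close>

definition tensor3_relators ::
  "(('m::ab_group_add \<times> 'n::ab_group_add) \<times> ('m \<times> 'n)) set
    \<Rightarrow> (('n \<times> 'p::ab_group_add) \<times> ('n \<times> 'p)) set \<Rightarrow> ('m \<times> 'n \<times> 'p \<Rightarrow>\<^sub>0 int) set"
  where "tensor3_relators Q Q' =
    {frag_of (m + m', n, p) - frag_of (m, n, p) - frag_of (m', n, p) | m m' n p. True} \<union>
    {frag_of (m, n + n', p) - frag_of (m, n, p) - frag_of (m, n', p) | m n n' p. True} \<union>
    {frag_of (m, n, p + p') - frag_of (m, n, p) - frag_of (m, n, p') | m n p p'. True} \<union>
    {frag_of (m, n, p) - frag_of (m', n', p) | m n m' n' p. ((m, n), (m', n')) \<in> Q} \<union>
    {frag_of (m, n, p) - frag_of (m, n', p') | m n p n' p'. ((n, p), (n', p')) \<in> Q'}"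

definition tensor3_eq ::
  "(('m::ab_group_add \<times> 'n::ab_group_add) \<times> ('m \<times> 'n)) set
    \<Rightarrow> (('n \<times> 'p::ab_group_add) \<times> ('n \<times> 'p)) set
    \<Rightarrow> (('m \<times> 'n \<times> 'p \<Rightarrow>\<^sub>0 int) \<times> ('m \<times> 'n \<times> 'p \<Rightarrow>\<^sub>0 int)) set"
  where "tensor3_eq Q Q' = {(u, v). u - v \<in> additive_span (tensor3_relators Q Q')}"

definition tens3 ::
  "(('m::ab_group_add \<times> 'n::ab_group_add) \<times> ('m \<times> 'n)) set
    \<Rightarrow> (('n \<times> 'p::ab_group_add) \<times> ('n \<times> 'p)) set
    \<Rightarrow> ('m \<times> 'n \<times> 'p) list \<Rightarrow> ('m, 'n, 'p) tensor3"
  where "tens3 Q Q' xs = tensor3_eq Q Q' `` {formal_sum xs}"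

text \<open>
  Sweedler notation: \<open>rep X\<close> is a chosen list \<open>[(m\<^sub>1, n\<^sub>1), \<dots>, (m\<^sub>j, n\<^sub>j)]\<close> with
  \<open>X = m\<^sub>1 \<otimes> n\<^sub>1 + \<dots> + m\<^sub>j \<otimes> n\<^sub>j\<close>, and \<open>(x, y) \<leftarrow> rep (\<gamma> h)\<close> is the implicit summation
  in \<open>\<gamma>(h) = h\<^sub>(\<^sub>1\<^sub>) \<otimes> h\<^sub>(\<^sub>2\<^sub>)\<close>.  Wherever \<open>rep\<close> is used below, the axioms make the
  expression additive in both components and balanced, so that its value does not depend on
  the chosen list.
\<close>

definition rep :: "('m, 'n) tensor \<Rightarrow> ('m \<times> 'n) list"
  where "rep X = (SOME xs. formal_sum xs \<in> X)"


section \<open>Bialgebroids and Hopf algebroids\<close>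

text \<open>
  The middle actions of \<open>H \<otimes>\<^sub>L H\<close> are \<open>h \<cdot> l = t(l) h\<close>, \<open>l \<cdot> h = s(l) h\<close>, and those of
  \<open>H \<otimes>\<^sub>R H\<close> are \<open>h \<cdot> r = h s(r)\<close>, \<open>r \<cdot> h = h t(r)\<close>.
\<close>

definition balL :: "('l \<Rightarrow> 'h::{ring,monoid_mult}) \<Rightarrow> ('l \<Rightarrow> 'h) \<Rightarrow> (('h \<times> 'h) \<times> ('h \<times> 'h)) set"
  where "balL s t = balance UNIV (\<lambda>h l. t l * h) (\<lambda>l h. s l * h)"

definition balR :: "('r \<Rightarrow> 'h::{ring,monoid_mult}) \<Rightarrow> ('r \<Rightarrow> 'h) \<Rightarrow> (('h \<times> 'h) \<times> ('h \<times> 'h)) set"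
  where "balR s t = balance UNIV (\<lambda>h r. h * s r) (\<lambda>r h. h * t r)"

locale left_bialgebroid =
  H: k_algebra kH + L: k_algebra kL
  for kH :: "'k::{comm_ring,monoid_mult} \<Rightarrow> 'h::{ring,monoid_mult} \<Rightarrow> 'h"
    and kL :: "'k \<Rightarrow> 'l::{ring,monoid_mult} \<Rightarrow> 'l" +
  fixes s t :: "'l \<Rightarrow> 'h"
    and \<gamma> :: "'h \<Rightarrow> ('h, 'h) tensor"
    and \<pi> :: "'h \<Rightarrow> 'l"
  assumes s_map: "algebra_map kL kH s"
    and t_map: "op_algebra_map kL kH t"
    and s_t_commute: "s l * t l' = t l' * s l"
    \<comment> \<open>\<open>\<gamma>\<close> and \<open>\<pi>\<close> are bimodule maps\<close>
    and \<gamma>_in: "\<gamma> h \<in> tensor_product (balL s t)"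
    and \<gamma>_add: "\<gamma> (h + h') = tens (balL s t) (rep (\<gamma> h) @ rep (\<gamma> h'))"
    and \<gamma>_s: "\<gamma> (s l * h) = tens (balL s t) [(s l * x, y). (x, y) \<leftarrow> rep (\<gamma> h)]"
    and \<gamma>_t: "\<gamma> (t l * h) = tens (balL s t) [(x, t l * y). (x, y) \<leftarrow> rep (\<gamma> h)]"
    and \<pi>_add: "\<pi> (h + h') = \<pi> h + \<pi> h'"
    and \<pi>_s: "\<pi> (s l * h) = l * \<pi> h"
    and \<pi>_t: "\<pi> (t l * h) = \<pi> h * l"
    \<comment> \<open>coring axioms\<close>
    and coassoc: "tens3 (balL s t) (balL s t) [(x1, x2, y). (x, y) \<leftarrow> rep (\<gamma> h), (x1, x2) \<leftarrow> rep (\<gamma> x)]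
      = tens3 (balL s t) (balL s t) [(x, y1, y2). (x, y) \<leftarrow> rep (\<gamma> h), (y1, y2) \<leftarrow> rep (\<gamma> y)]"
    and counit_left: "(\<Sum>(x, y)\<leftarrow>rep (\<gamma> h). s (\<pi> x) * y) = h"
    and counit_right: "(\<Sum>(x, y)\<leftarrow>rep (\<gamma> h). t (\<pi> y) * x) = h"
    \<comment> \<open>compatibility with the multiplication of \<open>H\<close>\<close>
    and takeuchi: "tens (balL s t) [(x * t l, y). (x, y) \<leftarrow> rep (\<gamma> h)]
      = tens (balL s t) [(x, y * s l). (x, y) \<leftarrow> rep (\<gamma> h)]"
    and \<gamma>_one: "\<gamma> 1 = tens (balL s t) [(1, 1)]"
    and \<gamma>_mult: "\<gamma> (h * h')
      = tens (balL s t) [(x * x', y * y'). (x, y) \<leftarrow> rep (\<gamma> h), (x', y') \<leftarrow> rep (\<gamma> h')]"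
    and \<pi>_one: "\<pi> 1 = 1"
    and \<pi>_mult_s: "\<pi> (h * s (\<pi> h')) = \<pi> (h * h')"
    and \<pi>_mult_t: "\<pi> (h * t (\<pi> h')) = \<pi> (h * h')"

locale right_bialgebroid =
  H: k_algebra kH + R: k_algebra kR
  for kH :: "'k::{comm_ring,monoid_mult} \<Rightarrow> 'h::{ring,monoid_mult} \<Rightarrow> 'h"
    and kR :: "'k \<Rightarrow> 'r::{ring,monoid_mult} \<Rightarrow> 'r" +
  fixes s t :: "'r \<Rightarrow> 'h"
    and \<gamma> :: "'h \<Rightarrow> ('h, 'h) tensor"
    and \<pi> :: "'h \<Rightarrow> 'r"
  assumes s_map: "algebra_map kR kH s"
    and t_map: "op_algebra_map kR kH t"
    and s_t_commute: "s r * t r' = t r' * s r"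
    \<comment> \<open>\<open>\<gamma>\<close> and \<open>\<pi>\<close> are bimodule maps\<close>
    and \<gamma>_in: "\<gamma> h \<in> tensor_product (balR s t)"
    and \<gamma>_add: "\<gamma> (h + h') = tens (balR s t) (rep (\<gamma> h) @ rep (\<gamma> h'))"
    and \<gamma>_t: "\<gamma> (h * t r) = tens (balR s t) [(x * t r, y). (x, y) \<leftarrow> rep (\<gamma> h)]"
    and \<gamma>_s: "\<gamma> (h * s r) = tens (balR s t) [(x, y * s r). (x, y) \<leftarrow> rep (\<gamma> h)]"
    and \<pi>_add: "\<pi> (h + h') = \<pi> h + \<pi> h'"
    and \<pi>_t: "\<pi> (h * t r) = r * \<pi> h"
    and \<pi>_s: "\<pi> (h * s r) = \<pi> h * r"
    \<comment> \<open>coring axioms\<close>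
    and coassoc: "tens3 (balR s t) (balR s t) [(x1, x2, y). (x, y) \<leftarrow> rep (\<gamma> h), (x1, x2) \<leftarrow> rep (\<gamma> x)]
      = tens3 (balR s t) (balR s t) [(x, y1, y2). (x, y) \<leftarrow> rep (\<gamma> h), (y1, y2) \<leftarrow> rep (\<gamma> y)]"
    and counit_left: "(\<Sum>(x, y)\<leftarrow>rep (\<gamma> h). y * t (\<pi> x)) = h"
    and counit_right: "(\<Sum>(x, y)\<leftarrow>rep (\<gamma> h). x * s (\<pi> y)) = h"
    \<comment> \<open>compatibility with the multiplication of \<open>H\<close>\<close>
    and takeuchi: "tens (balR s t) [(s r * x, y). (x, y) \<leftarrow> rep (\<gamma> h)]
      = tens (balR s t) [(x, t r * y). (x, y) \<leftarrow> rep (\<gamma> h)]"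
    and \<gamma>_one: "\<gamma> 1 = tens (balR s t) [(1, 1)]"
    and \<gamma>_mult: "\<gamma> (h * h')
      = tens (balR s t) [(x * x', y * y'). (x, y) \<leftarrow> rep (\<gamma> h), (x', y') \<leftarrow> rep (\<gamma> h')]"
    and \<pi>_one: "\<pi> 1 = 1"
    and \<pi>_mult_s: "\<pi> (s (\<pi> h) * h') = \<pi> (h * h')"
    and \<pi>_mult_t: "\<pi> (t (\<pi> h) * h') = \<pi> (h * h')"

locale hopf_algebroid =
  L: left_bialgebroid kH kL sL tL \<gamma>L \<pi>L + R: right_bialgebroid kH kR sR tR \<gamma>R \<pi>R
  for kH :: "'k::{comm_ring,monoid_mult} \<Rightarrow> 'h::{ring,monoid_mult} \<Rightarrow> 'h"
    and kL :: "'k \<Rightarrow> 'l::{ring,monoid_mult} \<Rightarrow> 'l" and sL tL \<gamma>L \<pi>L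
    and kR :: "'k \<Rightarrow> 'r::{ring,monoid_mult} \<Rightarrow> 'r" and sR tR \<gamma>R \<pi>R +
  fixes S :: "'h \<Rightarrow> 'h"
  assumes S_linear: "k_linear kH kH S"
    and sL_\<pi>L_tR: "sL (\<pi>L (tR r)) = tR r"
    and tL_\<pi>L_sR: "tL (\<pi>L (sR r)) = sR r"
    and sR_\<pi>R_tL: "sR (\<pi>R (tL l)) = tL l"
    and tR_\<pi>R_sL: "tR (\<pi>R (sL l)) = sL l"
    and coassoc_LR:
      "tens3 (balL sL tL) (balR sR tR) [(x1, x2, y). (x, y) \<leftarrow> rep (\<gamma>R h), (x1, x2) \<leftarrow> rep (\<gamma>L x)]
      = tens3 (balL sL tL) (balR sR tR) [(x, y1, y2). (x, y) \<leftarrow> rep (\<gamma>L h), (y1, y2) \<leftarrow> rep (\<gamma>R y)]"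
    and coassoc_RL:
      "tens3 (balR sR tR) (balL sL tL) [(x1, x2, y). (x, y) \<leftarrow> rep (\<gamma>L h), (x1, x2) \<leftarrow> rep (\<gamma>R x)]
      = tens3 (balR sR tR) (balL sL tL) [(x, y1, y2). (x, y) \<leftarrow> rep (\<gamma>R h), (y1, y2) \<leftarrow> rep (\<gamma>L y)]"
    and S_tL: "S (tL l * h * tL l') = sL l' * S h * sL l"
    and S_tR: "S (tR r * h * tR r') = sR r' * S h * sR r"
    and S_left: "(\<Sum>(x, y)\<leftarrow>rep (\<gamma>L h). S x * y) = sR (\<pi>R h)"
    and S_right: "(\<Sum>(x, y)\<leftarrow>rep (\<gamma>R h). x * S y) = sL (\<pi>L h)"


section \<open>Comodules and comodule algebras\<close>

text \<open>Middle actions of \<open>M \<otimes>\<^sub>R H\<close> and \<open>M \<otimes>\<^sub>L H\<close>, for a right action \<open>act\<close> on \<open>M\<close>.\<close>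

definition balMR :: "('r \<Rightarrow> 'h::{ring,monoid_mult}) \<Rightarrow> ('m \<Rightarrow> 'r \<Rightarrow> 'm) \<Rightarrow> (('m \<times> 'h) \<times> ('m \<times> 'h)) set"
  where "balMR tR act = balance UNIV act (\<lambda>r h. h * tR r)"

definition balML :: "('l \<Rightarrow> 'h::{ring,monoid_mult}) \<Rightarrow> ('m \<Rightarrow> 'l \<Rightarrow> 'm) \<Rightarrow> (('m \<times> 'h) \<times> ('m \<times> 'h)) set"
  where "balML sL act = balance UNIV act (\<lambda>l h. sL l * h)"

definition lactR ::
  "('r \<Rightarrow> 'h::{ring,monoid_mult}) \<Rightarrow> ('h \<Rightarrow> 'r) \<Rightarrow> ('m::ab_group_add \<Rightarrow> 'r \<Rightarrow> 'm)
    \<Rightarrow> ('m \<Rightarrow> ('m, 'h) tensor) \<Rightarrow> 'r \<Rightarrow> 'm \<Rightarrow> 'm"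
  where "lactR s \<pi> act \<tau> r m = (\<Sum>(m0, m1)\<leftarrow>rep (\<tau> m). act m0 (\<pi> (s r * m1)))"

definition lactL ::
  "('l \<Rightarrow> 'h::{ring,monoid_mult}) \<Rightarrow> ('h \<Rightarrow> 'l) \<Rightarrow> ('m::ab_group_add \<Rightarrow> 'l \<Rightarrow> 'm)
    \<Rightarrow> ('m \<Rightarrow> ('m, 'h) tensor) \<Rightarrow> 'l \<Rightarrow> 'm \<Rightarrow> 'm"
  where "lactL s \<pi> act \<tau> l m = (\<Sum>(m0, m1)\<leftarrow>rep (\<tau> m). act m0 (\<pi> (m1 * s l)))"

locale right_comodule_of_right_bialgebroid =
  right_bialgebroid kH kR s t \<gamma> \<pi> + M: k_module kM
  for kH :: "'k::{comm_ring,monoid_mult} \<Rightarrow> 'h::{ring,monoid_mult} \<Rightarrow> 'h"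
    and kR :: "'k \<Rightarrow> 'r::{ring,monoid_mult} \<Rightarrow> 'r" and s t \<gamma> \<pi>
    and kM :: "'k \<Rightarrow> 'm::ab_group_add \<Rightarrow> 'm" +
  fixes act :: "'m \<Rightarrow> 'r \<Rightarrow> 'm"
    and \<tau> :: "'m \<Rightarrow> ('m, 'h) tensor"
  assumes act_module: "right_module kR kM act"
    and \<tau>_in: "\<tau> m \<in> tensor_product (balMR t act)"
    and \<tau>_add: "\<tau> (m + m') = tens (balMR t act) (rep (\<tau> m) @ rep (\<tau> m'))"
    and \<tau>_act: "\<tau> (act m r) = tens (balMR t act) [(m0, m1 * s r). (m0, m1) \<leftarrow> rep (\<tau> m)]"
    and \<tau>_coassoc:
      "tens3 (balMR t act) (balR s t) [(x, y, m1). (m0, m1) \<leftarrow> rep (\<tau> m), (x, y) \<leftarrow> rep (\<tau> m0)]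
      = tens3 (balMR t act) (balR s t) [(m0, x, y). (m0, m1) \<leftarrow> rep (\<tau> m), (x, y) \<leftarrow> rep (\<gamma> m1)]"
    and \<tau>_counit: "(\<Sum>(m0, m1)\<leftarrow>rep (\<tau> m). act m0 (\<pi> m1)) = m"
    \<comment> \<open>the remaining two properties follow from the preceding ones\<close>
    and act_bimodule: "bimodule kR kM (lactR s \<pi> act \<tau>) act"
    and \<tau>_takeuchi:
      "tens (balMR t act) [(lactR s \<pi> act \<tau> r m0, m1). (m0, m1) \<leftarrow> rep (\<tau> m)]
      = tens (balMR t act) [(m0, t r * m1). (m0, m1) \<leftarrow> rep (\<tau> m)]"

locale right_comodule_of_left_bialgebroid =
  left_bialgebroid kH kL s t \<gamma> \<pi> + M: k_module kM
  for kH :: "'k::{comm_ring,monoid_mult} \<Rightarrow> 'h::{ring,monoid_mult} \<Rightarrow> 'h"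
    and kL :: "'k \<Rightarrow> 'l::{ring,monoid_mult} \<Rightarrow> 'l" and s t \<gamma> \<pi>
    and kM :: "'k \<Rightarrow> 'm::ab_group_add \<Rightarrow> 'm" +
  fixes act :: "'m \<Rightarrow> 'l \<Rightarrow> 'm"
    and \<tau> :: "'m \<Rightarrow> ('m, 'h) tensor"
  assumes act_module: "right_module kL kM act"
    and \<tau>_in: "\<tau> m \<in> tensor_product (balML s act)"
    and \<tau>_add: "\<tau> (m + m') = tens (balML s act) (rep (\<tau> m) @ rep (\<tau> m'))"
    and \<tau>_act: "\<tau> (act m l) = tens (balML s act) [(m0, t l * m1). (m0, m1) \<leftarrow> rep (\<tau> m)]"
    and \<tau>_coassoc:
      "tens3 (balML s act) (balL s t) [(x, y, m1). (m0, m1) \<leftarrow> rep (\<tau> m), (x, y) \<leftarrow> rep (\<tau> m0)]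
      = tens3 (balML s act) (balL s t) [(m0, x, y). (m0, m1) \<leftarrow> rep (\<tau> m), (x, y) \<leftarrow> rep (\<gamma> m1)]"
    and \<tau>_counit: "(\<Sum>(m0, m1)\<leftarrow>rep (\<tau> m). act m0 (\<pi> m1)) = m"
    \<comment> \<open>the remaining two properties follow from the preceding ones\<close>
    and act_bimodule: "bimodule kL kM (lactL s \<pi> act \<tau>) act"
    and \<tau>_takeuchi:
      "tens (balML s act) [(lactL s \<pi> act \<tau> l m0, m1). (m0, m1) \<leftarrow> rep (\<tau> m)]
      = tens (balML s act) [(m0, m1 * s l). (m0, m1) \<leftarrow> rep (\<tau> m)]"

locale hopf_comodule =
  hopf_algebroid kH kL sL tL \<gamma>L \<pi>L kR sR tR \<gamma>R \<pi>R S +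
  CL: right_comodule_of_left_bialgebroid kH kL sL tL \<gamma>L \<pi>L kM actL \<tau>L +
  CR: right_comodule_of_right_bialgebroid kH kR sR tR \<gamma>R \<pi>R kM actR \<tau>R
  for kH :: "'k::{comm_ring,monoid_mult} \<Rightarrow> 'h::{ring,monoid_mult} \<Rightarrow> 'h"
    and kL :: "'k \<Rightarrow> 'l::{ring,monoid_mult} \<Rightarrow> 'l" and sL tL \<gamma>L \<pi>L
    and kR :: "'k \<Rightarrow> 'r::{ring,monoid_mult} \<Rightarrow> 'r" and sR tR \<gamma>R \<pi>R S
    and kM :: "'k \<Rightarrow> 'm::ab_group_add \<Rightarrow> 'm" and actL \<tau>L actR \<tau>R +
  assumes actions_L_R:
      "lactL sL \<pi>L actL \<tau>L l (actL m l') = lactR sR \<pi>R actR \<tau>R (\<pi>R (tL l')) (actR m (\<pi>R (tL l)))"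
    and \<tau>_coassoc_RL:
      "tens3 (balMR tR actR) (balL sL tL) [(x, y, m1). (m0, m1) \<leftarrow> rep (\<tau>L m), (x, y) \<leftarrow> rep (\<tau>R m0)]
      = tens3 (balMR tR actR) (balL sL tL) [(m0, x, y). (m0, m1) \<leftarrow> rep (\<tau>R m), (x, y) \<leftarrow> rep (\<gamma>L m1)]"
    and \<tau>_coassoc_LR:
      "tens3 (balML sL actL) (balR sR tR) [(x, y, m1). (m0, m1) \<leftarrow> rep (\<tau>R m), (x, y) \<leftarrow> rep (\<tau>L m0)]
      = tens3 (balML sL actL) (balR sR tR) [(m0, x, y). (m0, m1) \<leftarrow> rep (\<tau>L m), (x, y) \<leftarrow> rep (\<gamma>R m1)]"

locale hopf_comodule_algebra =
  hopf_comodule kH kL sL tL \<gamma>L \<pi>L kR sR tR \<gamma>R \<pi>R S kA actL \<tau>L actR \<tau>R + A: k_algebra kA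
  for kH :: "'k::{comm_ring,monoid_mult} \<Rightarrow> 'h::{ring,monoid_mult} \<Rightarrow> 'h"
    and kL :: "'k \<Rightarrow> 'l::{ring,monoid_mult} \<Rightarrow> 'l" and sL tL \<gamma>L \<pi>L
    and kR :: "'k \<Rightarrow> 'r::{ring,monoid_mult} \<Rightarrow> 'r" and sR tR \<gamma>R \<pi>R S
    and kA :: "'k \<Rightarrow> 'a::{ring,monoid_mult} \<Rightarrow> 'a" and actL \<tau>L actR \<tau>R +
  assumes
    \<comment> \<open>\<open>A\<close> is an \<open>R\<close>-ring: its multiplication \<open>A \<otimes>\<^sub>R A \<rightarrow> A\<close> and unit \<open>r \<mapsto> 1 \<cdot> r\<close> are bimodule maps\<close>
    R_ring_left: "lactR sR \<pi>R actR \<tau>R r (a * a') = lactR sR \<pi>R actR \<tau>R r a * a'"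
    and R_ring_right: "actR (a * a') r = a * actR a' r"
    and R_ring_balanced: "actR a r * a' = a * lactR sR \<pi>R actR \<tau>R r a'"
    and R_ring_unit: "lactR sR \<pi>R actR \<tau>R r 1 = actR 1 r"
    and \<tau>R_one: "\<tau>R 1 = tens (balMR tR actR) [(1, 1)]"
    and \<tau>R_mult: "\<tau>R (a * a')
      = tens (balMR tR actR) [(x * x', y * y'). (x, y) \<leftarrow> rep (\<tau>R a), (x', y') \<leftarrow> rep (\<tau>R a')]"
    \<comment> \<open>\<open>A\<close> is an \<open>L\<^sup>o\<^sup>p\<close>-ring\<close>
    and Lop_ring_right: "actL a l = actL 1 l * a"
    and Lop_ring_left: "lactL sL \<pi>L actL \<tau>L l a = a * actL 1 l"
    and Lop_ring_unit: "lactL sL \<pi>L actL \<tau>L l 1 = actL 1 l"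
    and \<tau>L_one: "\<tau>L 1 = tens (balML sL actL) [(1, 1)]"
    and \<tau>L_mult: "\<tau>L (a * a')
      = tens (balML sL actL) [(x * x', y * y'). (x, y) \<leftarrow> rep (\<tau>L a), (x', y') \<leftarrow> rep (\<tau>L a')]"


section \<open>Coinvariants and canonical maps\<close>

definition coinvariants_R ::
  "('r \<Rightarrow> 'h::{ring,monoid_mult}) \<Rightarrow> ('a::ab_group_add \<Rightarrow> 'r \<Rightarrow> 'a) \<Rightarrow> ('a \<Rightarrow> ('a, 'h) tensor) \<Rightarrow> 'a set"
  where "coinvariants_R tR actR \<tau>R = {a. \<tau>R a = tens (balMR tR actR) [(a, 1)]}"

definition coinvariants_L ::
  "('l \<Rightarrow> 'h::{ring,monoid_mult}) \<Rightarrow> ('a::ab_group_add \<Rightarrow> 'l \<Rightarrow> 'a) \<Rightarrow> ('a \<Rightarrow> ('a, 'h) tensor) \<Rightarrow> 'a set"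
  where "coinvariants_L sL actL \<tau>L = {a. \<tau>L a = tens (balML sL actL) [(a, 1)]}"

text \<open>Middle actions of \<open>A \<otimes>\<^sub>B A\<close>, for a subring \<open>B\<close> of \<open>A\<close>.\<close>

definition balAA :: "'a::ring set \<Rightarrow> (('a \<times> 'a) \<times> ('a \<times> 'a)) set"
  where "balAA B = balance B (*) (*)"

definition can_R ::
  "('r \<Rightarrow> 'h::{ring,monoid_mult}) \<Rightarrow> ('a::{ring,monoid_mult} \<Rightarrow> 'r \<Rightarrow> 'a) \<Rightarrow> ('a \<Rightarrow> ('a, 'h) tensor)
    \<Rightarrow> ('a, 'a) tensor \<Rightarrow> ('a, 'h) tensor"
  where "can_R tR actR \<tau>R X =
    tens (balMR tR actR) [(a * x, y). (a, a') \<leftarrow> rep X, (x, y) \<leftarrow> rep (\<tau>R a')]"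

definition can_L ::
  "('l \<Rightarrow> 'h::{ring,monoid_mult}) \<Rightarrow> ('a::{ring,monoid_mult} \<Rightarrow> 'l \<Rightarrow> 'a) \<Rightarrow> ('a \<Rightarrow> ('a, 'h) tensor)
    \<Rightarrow> ('a, 'a) tensor \<Rightarrow> ('a, 'h) tensor"
  where "can_L sL actL \<tau>L X =
    tens (balML sL actL) [(x * a', y). (a, a') \<leftarrow> rep X, (x, y) \<leftarrow> rep (\<tau>L a)]"

end

theory Submission
  imports Defs "HOL-Library.Multiset"
begin

text \<open>
  The map \<open>a \<otimes>\<^sub>R h \<mapsto> a\<^sub>\<langle>\<^sub>0\<^sub>\<rangle> \<otimes>\<^sub>L a\<^sub>\<langle>\<^sub>1\<^sub>\<rangle> S(h)\<close> is a bijection \<open>A \<otimes>\<^sub>R H \<rightarrow> A \<otimes>\<^sub>L H\<close> with inverse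
  \<open>a \<otimes>\<^sub>L h \<mapsto> a\<^sup>\<langle>\<^sup>0\<^sup>\<rangle> \<otimes>\<^sub>R S\<^sup>-\<^sup>1(h) a\<^sup>\<langle>\<^sup>1\<^sup>\<rangle>\<close>.  It carries \<open>can\<^sub>R\<close> to \<open>can\<^sub>L\<close>, it maps \<open>\<tau>\<^sub>R(a)\<close> to \<open>a \<otimes>\<^sub>L 1\<close>, and it
  maps \<open>a \<otimes>\<^sub>R 1\<close> to \<open>\<tau>\<^sub>L(a)\<close>, so \<open>\<tau>\<^sub>R(a) = a \<otimes>\<^sub>R 1\<close> if and only if \<open>\<tau>\<^sub>L(a) = a \<otimes>\<^sub>L 1\<close>.

  Bijectivity uses that \<open>S\<close> is anti-multiplicative, which is not an axiom.  It follows by evaluating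
  \<open>S(h\<^sub>1 k\<^sub>1) h\<^sub>2\<^sup>1 k\<^sub>2\<^sup>1 S(k\<^sub>2\<^sup>2) S(h\<^sub>2\<^sup>2)\<close> in two ways, once directly, giving \<open>S(hk)\<close>, and once after
  mixed coassociativity in \<open>h\<close> and in \<open>k\<close>, giving \<open>S(k) S(h)\<close>.
\<close>


section \<open>Evaluating balanced maps on tensors\<close>

text \<open>
  No type carries the group structure of a tensor product over given actions, so maps into
  \<open>M \<otimes> N\<close> are replaced by maps into the free group, with equations modulo the subgroup of relators.
\<close>

definition span_cong :: "'x::ab_group_add \<Rightarrow> 'x set \<Rightarrow> 'x \<Rightarrow> bool" ("(_/ \<approx>[_]/ _)" [51, 0, 51] 50)
  where "x \<approx>[E] y \<longleftrightarrow> x - y \<in> additive_span E"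

lemma additive_span_uminus: "x \<in> additive_span E \<Longrightarrow> - x \<in> additive_span E"
  using additive_span.diff[OF additive_span.zero, of x E] by simp

lemma additive_span_add: "x \<in> additive_span E \<Longrightarrow> y \<in> additive_span E \<Longrightarrow> x + y \<in> additive_span E"
  using additive_span.diff[of x E "- y"] additive_span_uminus[of y E] by simp

lemma span_cong_refl [simp, intro]: "x \<approx>[E] x"
  by (simp add: span_cong_def additive_span.zero)

lemma span_cong_sym: "x \<approx>[E] y \<Longrightarrow> y \<approx>[E] x"
  using additive_span_uminus[of "x - y" E] by (simp add: span_cong_def)

lemma span_cong_trans [trans]: "x \<approx>[E] y \<Longrightarrow> y \<approx>[E] z \<Longrightarrow> x \<approx>[E] z"
  using additive_span_add[of "x - y" E "y - z"] by (simp add: span_cong_def)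

lemma span_cong_add: "x \<approx>[E] y \<Longrightarrow> x' \<approx>[E] y' \<Longrightarrow> x + x' \<approx>[E] y + y'"
  using additive_span_add[of "x - y" E "x' - y'"] by (simp add: span_cong_def algebra_simps)

lemma span_cong_add_left_iff [simp]: "z + x \<approx>[E] z + y \<longleftrightarrow> x \<approx>[E] y"
  by (simp add: span_cong_def)

text \<open>Identities in \<open>H\<close> itself are thereby the case \<open>E = {}\<close> of the
  congruence lemmas, so one calculus serves both for equations in \<open>H\<close> and for equations
  in tensor products.\<close>

lemma span_cong_empty_iff [simp]: "x \<approx>[{}] y \<longleftrightarrow> x = y"
proof -
  have "z = 0" if "z \<in> additive_span {}" for z :: 'a
    using that by induction auto
  from this[of "x - y"] show ?thesis
    by (auto simp: span_cong_def additive_span.zero)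
qed

lemma span_cong_sum_list:
  "(\<And>x. x \<in> set xs \<Longrightarrow> f x \<approx>[E] g x) \<Longrightarrow> (\<Sum>x\<leftarrow>xs. f x) \<approx>[E] (\<Sum>x\<leftarrow>xs. g x)"
  by (induction xs) (auto intro: span_cong_add)

section \<open>Lists as elements of the free abelian group\<close>

lemma formal_sum_Nil [simp]: "formal_sum [] = 0"
  and formal_sum_Cons [simp]: "formal_sum (x # xs) = frag_of x + formal_sum xs"
  and formal_sum_append [simp]: "formal_sum (xs @ ys) = formal_sum xs + formal_sum ys"
  by (simp_all add: formal_sum_def)

lemma lookup_formal_sum: "Poly_Mapping.lookup (formal_sum xs) x = int (count (mset xs) x)"
  by (induction xs) (auto simp: lookup_add lookup_single)

lemma formal_sum_eq_iff: "formal_sum xs = formal_sum ys \<longleftrightarrow> mset xs = mset ys"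
  by (auto simp: poly_mapping_eq_iff fun_eq_iff multiset_eq_iff lookup_formal_sum)

lemma frag_eq_formal_sum_diff: "\<exists>xs ys. c = formal_sum xs - formal_sum ys"
proof -
  have "Poly_Mapping.keys c \<subseteq> UNIV"
    by simp
  then show ?thesis
  proof (induction rule: frag_induction)
    case zero
    then show ?case
      by (metis diff_self)
  next
    case (one x)
    have "frag_of x = formal_sum [x] - formal_sum []"
      by simp
    then show ?case
      by blast
  next
    case (diff a b)
    then obtain xs ys us vs where "a = formal_sum xs - formal_sum ys" "b = formal_sum us - formal_sum vs"
      by blast
    then have "a - b = formal_sum (xs @ vs) - formal_sum (ys @ us)"
      by simp
    then show ?case
      by blast
  qed
qed

text \<open>A list-level substitute for extending \<open>f\<close> to a homomorphism on the free
  group: it is enough that \<open>f\<close> sends each relator in \<open>G\<close> into the subgroup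
  spanned by \<open>E\<close>.\<close>

lemma formal_sum_eval:
  assumes "formal_sum xs \<approx>[G] formal_sum ys"
    and "\<And>g. g \<in> G \<Longrightarrow> \<exists>us vs. g = formal_sum us - formal_sum vs \<and> (\<Sum>x\<leftarrow>us. f x) \<approx>[E] (\<Sum>x\<leftarrow>vs. f x)"
  shows "(\<Sum>x\<leftarrow>xs. f x) \<approx>[E] (\<Sum>x\<leftarrow>ys. f x)"
proof -
  \<comment> \<open>The property assumed of generators passes to the whole span: for a difference,
    the lists are concatenated crosswise.\<close>
  have "\<exists>us vs. c = formal_sum us - formal_sum vs \<and> (\<Sum>x\<leftarrow>us. f x) \<approx>[E] (\<Sum>x\<leftarrow>vs. f x)"
    if "c \<in> additive_span G" for c
    using that
  proof induction
    case zero
    then show ?case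
      by (intro exI[of _ "[]"]) auto
  next
    case (gen x)
    then show ?case
      by (rule assms)
  next
    case (diff x y)
    then obtain us vs us' vs'
      where xy: "x = formal_sum us - formal_sum vs" "y = formal_sum us' - formal_sum vs'"
        and cong: "(\<Sum>x\<leftarrow>us. f x) \<approx>[E] (\<Sum>x\<leftarrow>vs. f x)" "(\<Sum>x\<leftarrow>us'. f x) \<approx>[E] (\<Sum>x\<leftarrow>vs'. f x)"
      by (elim exE conjE)
    from xy span_cong_add[OF cong(1) span_cong_sym[OF cong(2)]] have "x - y = formal_sum (us @ vs') - formal_sum (vs @ us')
        \<and> (\<Sum>x\<leftarrow>us @ vs'. f x) \<approx>[E] (\<Sum>x\<leftarrow>vs @ us'. f x)"
      by simp
    then show ?case
      by blast
  qed
  then obtain us vs where *: "formal_sum xs - formal_sum ys = formal_sum us - formal_sum vs"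
    and cong: "(\<Sum>x\<leftarrow>us. f x) \<approx>[E] (\<Sum>x\<leftarrow>vs. f x)"
    using assms(1) unfolding span_cong_def by blast
  \<comment> \<open>Moving the negative parts across leaves formal sums only, and these determine
    the multiset of entries, hence the value of the sum of \<open>f\<close>.\<close>
  from * have "formal_sum (xs @ vs) = formal_sum (ys @ us)"
    by (simp add: algebra_simps)
  then have "mset (map f (xs @ vs)) = mset (map f (ys @ us))"
    by (simp only: formal_sum_eq_iff mset_map)
  then have "(\<Sum>x\<leftarrow>xs @ vs. f x) = (\<Sum>x\<leftarrow>ys @ us. f x)"
    using sum_mset_sum_list by metis
  then have "(\<Sum>x\<leftarrow>xs. f x) - (\<Sum>x\<leftarrow>ys. f x) = (\<Sum>x\<leftarrow>us. f x) - (\<Sum>x\<leftarrow>vs. f x)"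
    by (simp add: algebra_simps)
  with cong show ?thesis
    by (simp add: span_cong_def)
qed

section \<open>Balanced maps and the universal property of the tensor product\<close>

text \<open>The conditions hold only modulo \<open>E\<close>, so that \<open>f\<close> may take
  values in the free group underlying another tensor product, with \<open>E\<close> its
  relators.\<close>

definition balanced ::
  "'x::ab_group_add set \<Rightarrow> (('m::ab_group_add \<times> 'n::ab_group_add) \<times> ('m \<times> 'n)) set \<Rightarrow> ('m \<Rightarrow> 'n \<Rightarrow> 'x) \<Rightarrow> bool"
  where "balanced E Q f \<longleftrightarrow>
    (\<forall>m m' n. f (m + m') n \<approx>[E] f m n + f m' n) \<and>
    (\<forall>m n n'. f m (n + n') \<approx>[E] f m n + f m n') \<and>
    (\<forall>m n m' n'. ((m, n), (m', n')) \<in> Q \<longrightarrow> f m n \<approx>[E] f m' n')"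

definition balanced3 ::
  "'x::ab_group_add set \<Rightarrow> (('m::ab_group_add \<times> 'n::ab_group_add) \<times> ('m \<times> 'n)) set
    \<Rightarrow> (('n \<times> 'p::ab_group_add) \<times> ('n \<times> 'p)) set \<Rightarrow> ('m \<Rightarrow> 'n \<Rightarrow> 'p \<Rightarrow> 'x) \<Rightarrow> bool"
  where "balanced3 E Q Q' f \<longleftrightarrow>
    (\<forall>p. balanced E Q (\<lambda>m n. f m n p)) \<and> (\<forall>m. balanced E Q' (f m))"

lemma balanced_balance_iff:
  "balanced E (balance R ract lact) f \<longleftrightarrow>
    (\<forall>m m' n. f (m + m') n \<approx>[E] f m n + f m' n) \<and>
    (\<forall>m n n'. f m (n + n') \<approx>[E] f m n + f m n') \<and>
    (\<forall>m r n. r \<in> R \<longrightarrow> f (ract m r) n \<approx>[E] f m (lact r n))"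
  unfolding balanced_def balance_def by blast

lemma balanced_zero_left: "balanced E Q f \<Longrightarrow> f 0 n \<approx>[E] 0"
  and balanced_zero_right: "balanced E Q f \<Longrightarrow> f m 0 \<approx>[E] 0"
proof -
  assume f: "balanced E Q f"
  have "f (0 + 0) n \<approx>[E] f 0 n + f 0 n" "f m (0 + 0) \<approx>[E] f m 0 + f m 0"
    using f unfolding balanced_def by blast+
  then show "f 0 n \<approx>[E] 0" "f m 0 \<approx>[E] 0"
    by (auto simp: span_cong_def intro: additive_span_uminus dest: additive_span_uminus)
qed

lemma balanced_sum_list_left:
  assumes "balanced E Q f"
  shows "(\<Sum>x\<leftarrow>xs. f (g x) n) \<approx>[E] f (\<Sum>x\<leftarrow>xs. g x) n"
proof (induction xs)
  case Nil
  then show ?case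
    using balanced_zero_left[OF assms] by (simp add: span_cong_sym)
next
  case (Cons x xs)
  have "(\<Sum>x\<leftarrow>x # xs. f (g x) n) \<approx>[E] f (g x) n + f (\<Sum>x\<leftarrow>xs. g x) n"
    using Cons by simp
  also have "\<dots> \<approx>[E] f (\<Sum>x\<leftarrow>x # xs. g x) n"
    using assms by (auto simp: balanced_def intro: span_cong_sym)
  finally show ?case .
qed

lemma balanced_sum_list_right:
  assumes "balanced E Q f"
  shows "(\<Sum>x\<leftarrow>xs. f m (g x)) \<approx>[E] f m (\<Sum>x\<leftarrow>xs. g x)"
proof (induction xs)
  case Nil
  then show ?case
    using balanced_zero_right[OF assms] by (simp add: span_cong_sym)
next
  case (Cons x xs)
  have "(\<Sum>x\<leftarrow>x # xs. f m (g x)) \<approx>[E] f m (g x) + f m (\<Sum>x\<leftarrow>xs. g x)"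
    using Cons by simp
  also have "\<dots> \<approx>[E] f m (\<Sum>x\<leftarrow>x # xs. g x)"
    using assms by (auto simp: balanced_def intro: span_cong_sym)
  finally show ?case .
qed

text \<open>This is the universal balanced map; evaluating a tensor at it recovers the
  tensor.\<close>

lemma balanced_frag_of: "balanced (tensor_relators Q) Q (\<lambda>m n. frag_of (m, n))"
  unfolding balanced_def span_cong_def diff_diff_eq[symmetric]
  by (intro conjI allI impI additive_span.gen; unfold tensor_relators_def; blast)

lemma equiv_tensor_eq: "equiv UNIV (tensor_eq Q)"
  and equiv_tensor3_eq: "equiv UNIV (tensor3_eq Q Q')"
  unfolding tensor_eq_def tensor3_eq_def span_cong_def[symmetric]
  by (auto intro!: equivI reflI symI transI intro: span_cong_sym span_cong_trans)

lemma tens_eq_iff: "tens Q xs = tens Q ys \<longleftrightarrow> formal_sum xs \<approx>[tensor_relators Q] formal_sum ys"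
  by (simp add: tens_def eq_equiv_class_iff[OF equiv_tensor_eq]) (simp add: tensor_eq_def span_cong_def)

lemma tens3_eq_iff:
  "tens3 Q Q' xs = tens3 Q Q' ys \<longleftrightarrow> formal_sum xs \<approx>[tensor3_relators Q Q'] formal_sum ys"
  by (simp add: tens3_def eq_equiv_class_iff[OF equiv_tensor3_eq]) (simp add: tensor3_eq_def span_cong_def)

lemma tens_in_tensor_product [simp]: "tens Q xs \<in> tensor_product Q"
  by (simp add: tens_def tensor_product_def quotientI)

text \<open>A class is given by an integer combination of pure tensors. Since
  \<open>- (m \<otimes> n) = (- m) \<otimes> n\<close>, negative coefficients can be absorbed into
  the first component. This legitimates the choice made by \<open>rep\<close>.\<close>

lemma tensor_product_eq_tens:
  assumes "X \<in> tensor_product Q"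
  shows "\<exists>xs. formal_sum xs \<in> X"
proof -
  let ?R = "tensor_relators Q"
  obtain c where c: "X = tensor_eq Q `` {c}"
    using assms by (auto simp: tensor_product_def elim: quotientE)
  obtain xs ys where xy: "c = formal_sum xs - formal_sum ys"
    using frag_eq_formal_sum_diff by blast
  have "- frag_of (m, n) \<approx>[?R] frag_of (- m, n)" for m n
  proof -
    have "frag_of (m + - m, n) \<approx>[?R] frag_of (m, n) + frag_of (- m, n)"
      using balanced_frag_of unfolding balanced_def by blast
    then have "frag_of (0, n) \<approx>[?R] frag_of (m, n) + frag_of (- m, n)"
      by simp
    from span_cong_trans[OF span_cong_sym[OF this] balanced_zero_left[OF balanced_frag_of]]
    have "frag_of (m, n) + frag_of (- m, n) \<approx>[?R] 0" .
    from additive_span_uminus[OF this[unfolded span_cong_def]] show ?thesis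
      by (simp add: span_cong_def algebra_simps)
  qed
  then have "(\<Sum>(m, n)\<leftarrow>ys. - frag_of (m, n)) \<approx>[?R] (\<Sum>(m, n)\<leftarrow>ys. frag_of (- m, n))"
    by (intro span_cong_sum_list) auto
  moreover have "(\<Sum>(m, n)\<leftarrow>ys. - frag_of (m, n)) = - formal_sum ys"
    by (induction ys) auto
  moreover have "(\<Sum>(m, n)\<leftarrow>ys. frag_of (- m, n)) = formal_sum (map (\<lambda>(m, n). (- m, n)) ys)"
    by (induction ys) auto
  ultimately have "c \<approx>[?R] formal_sum (xs @ map (\<lambda>(m, n). (- m, n)) ys)"
    using xy by (simp only: formal_sum_append diff_conv_add_uminus span_cong_add_left_iff)
  then show ?thesis
    using c unfolding tensor_eq_def span_cong_def by blast
qed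

lemma tens_rep:
  assumes "X \<in> tensor_product Q"
  shows "tens Q (rep X) = X"
proof -
  have "formal_sum (rep X) \<in> X"
    unfolding rep_def using tensor_product_eq_tens[OF assms] by (rule someI_ex)
  moreover obtain c where c: "X = tensor_eq Q `` {c}"
    using assms unfolding tensor_product_def by (rule quotientE)
  ultimately have "(c, formal_sum (rep X)) \<in> tensor_eq Q"
    by simp
  with c show ?thesis
    unfolding tens_def using equiv_class_eq[OF equiv_tensor_eq] by metis
qed

text \<open>The existence half of the universal property: each kind of relator is matched by one
  clause of \<open>balanced\<close>.\<close>

lemma tens_eval:
  assumes f: "balanced E Q f" and eq: "tens Q xs = tens Q ys"
  shows "(\<Sum>(x, y)\<leftarrow>xs. f x y) \<approx>[E] (\<Sum>(x, y)\<leftarrow>ys. f x y)"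
proof (rule formal_sum_eval)
  show "formal_sum xs \<approx>[tensor_relators Q] formal_sum ys"
    using eq by (simp add: tens_eq_iff)
  fix g assume "g \<in> tensor_relators Q"
  then consider
      (1) m m' n where "g = frag_of (m + m', n) - frag_of (m, n) - frag_of (m', n)"
    | (2) m n n' where "g = frag_of (m, n + n') - frag_of (m, n) - frag_of (m, n')"
    | (3) p q where "g = frag_of p - frag_of q" "(p, q) \<in> Q"
    unfolding tensor_relators_def by blast
  then show "\<exists>us vs. g = formal_sum us - formal_sum vs
      \<and> (\<Sum>(x, y)\<leftarrow>us. f x y) \<approx>[E] (\<Sum>(x, y)\<leftarrow>vs. f x y)"
  proof cases
    case 1
    then show ?thesis
      using f by (intro exI[of _ "[(m + m', n)]"] exI[of _ "[(m, n), (m', n)]"]) (simp add: balanced_def)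
  next
    case 2
    then show ?thesis
      using f by (intro exI[of _ "[(m, n + n')]"] exI[of _ "[(m, n), (m, n')]"]) (simp add: balanced_def)
  next
    case 3
    then show ?thesis
      using f by (intro exI[of _ "[p]"] exI[of _ "[q]"]) (cases p; cases q; simp add: balanced_def)
  qed
qed

lemma tens3_eval:
  assumes f: "balanced3 E Q Q' f" and eq: "tens3 Q Q' xs = tens3 Q Q' ys"
  shows "(\<Sum>(x, y, z)\<leftarrow>xs. f x y z) \<approx>[E] (\<Sum>(x, y, z)\<leftarrow>ys. f x y z)"
proof (rule formal_sum_eval)
  show "formal_sum xs \<approx>[tensor3_relators Q Q'] formal_sum ys"
    using eq by (simp add: tens3_eq_iff)
  fix g assume "g \<in> tensor3_relators Q Q'"
  then consider
      (1) m m' n p where "g = frag_of (m + m', n, p) - frag_of (m, n, p) - frag_of (m', n, p)"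
    | (2) m n n' p where "g = frag_of (m, n + n', p) - frag_of (m, n, p) - frag_of (m, n', p)"
    | (3) m n p p' where "g = frag_of (m, n, p + p') - frag_of (m, n, p) - frag_of (m, n, p')"
    | (4) m n p m' n' where "g = frag_of (m, n, p) - frag_of (m', n', p)" "((m, n), (m', n')) \<in> Q"
    | (5) m n p n' p' where "g = frag_of (m, n, p) - frag_of (m, n', p')" "((n, p), (n', p')) \<in> Q'"
    unfolding tensor3_relators_def Un_iff mem_Collect_eq by (elim disjE exE conjE) metis+
  then show "\<exists>us vs. g = formal_sum us - formal_sum vs
      \<and> (\<Sum>(x, y, z)\<leftarrow>us. f x y z) \<approx>[E] (\<Sum>(x, y, z)\<leftarrow>vs. f x y z)"
  proof cases
    case 1
    then show ?thesis
      using f by (intro exI[of _ "[(m + m', n, p)]"] exI[of _ "[(m, n, p), (m', n, p)]"])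
        (simp add: balanced3_def balanced_def)
  next
    case 2
    then show ?thesis
      using f by (intro exI[of _ "[(m, n + n', p)]"] exI[of _ "[(m, n, p), (m, n', p)]"])
        (simp add: balanced3_def balanced_def)
  next
    case 3
    then show ?thesis
      using f by (intro exI[of _ "[(m, n, p + p')]"] exI[of _ "[(m, n, p), (m, n, p')]"])
        (simp add: balanced3_def balanced_def)
  next
    case 4
    then show ?thesis
      using f by (intro exI[of _ "[(m, n, p)]"] exI[of _ "[(m', n', p)]"])
        (simp add: balanced3_def balanced_def)
  next
    case 5
    then show ?thesis
      using f by (intro exI[of _ "[(m, n, p)]"] exI[of _ "[(m, n', p')]"])
        (simp add: balanced3_def balanced_def)
  qed
qed

section \<open>Sweedler sums\<close>

text \<open>Sweedler's implicit summation. For unbalanced \<open>f\<close> the value depends on the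
  list chosen by \<open>rep\<close>, but rules valid for every list, such as exchanging two sums,
  still apply.\<close>

definition tsum :: "('m, 'n) tensor \<Rightarrow> ('m \<Rightarrow> 'n \<Rightarrow> 'x::ab_group_add) \<Rightarrow> 'x"
  where "tsum X f = (\<Sum>(x, y)\<leftarrow>rep X. f x y)"

lemma tsum_tens: "balanced E Q f \<Longrightarrow> tsum (tens Q xs) f \<approx>[E] (\<Sum>(x, y)\<leftarrow>xs. f x y)"
  unfolding tsum_def by (erule tens_eval) (rule tens_rep[OF tens_in_tensor_product])

text \<open>Comparison under the universal balanced map; equalities in
  \<open>A \<otimes>\<^sub>R H\<close> and \<open>A \<otimes>\<^sub>L H\<close> are later proved
  this way.\<close>

lemma tensor_eqI:
  assumes "X \<in> tensor_product Q" "Y \<in> tensor_product Q"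
    and "tsum X (\<lambda>x y. frag_of (x, y)) \<approx>[tensor_relators Q] tsum Y (\<lambda>x y. frag_of (x, y))"
  shows "X = Y"
proof -
  have "tens Q (rep X) = tens Q (rep Y)"
    using assms(3) by (simp add: tens_eq_iff tsum_def formal_sum_def case_prod_unfold)
  then show ?thesis
    using assms by (simp add: tens_rep)
qed

lemma tsum_cong: "(\<And>x y. f x y \<approx>[E] g x y) \<Longrightarrow> tsum X f \<approx>[E] tsum X g"
  unfolding tsum_def by (rule span_cong_sum_list) auto

lemma tsum_swap:
  fixes f :: "_ \<Rightarrow> _ \<Rightarrow> _ \<Rightarrow> _ \<Rightarrow> 'x::ab_group_add"
  shows "tsum X (\<lambda>x y. tsum Y (f x y)) = tsum Y (\<lambda>u v. tsum X (\<lambda>x y. f x y u v))"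
proof -
  have "(\<Sum>x\<leftarrow>xs. \<Sum>y\<leftarrow>ys. g x y) = (\<Sum>y\<leftarrow>ys. \<Sum>x\<leftarrow>xs. g x y)" for xs ys and g :: "_ \<Rightarrow> _ \<Rightarrow> 'x"
    by (induction xs) (simp_all add: sum_list_addf)
  then show ?thesis
    by (simp add: tsum_def case_prod_unfold)
qed

lemma tsum_add: "tsum X (\<lambda>x y. f x y + g x y) = tsum X f + tsum X g"
  by (simp add: tsum_def case_prod_unfold sum_list_addf)

lemma tsum_mult_left: "tsum X (\<lambda>x y. c * f x y) = c * tsum X f"
  and tsum_mult_right: "tsum X (\<lambda>x y. f x y * c) = tsum X f * c" for c :: "'x::ring"
  by (simp_all add: tsum_def case_prod_unfold sum_list_const_mult sum_list_mult_const)

lemma tsum_additive: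
  fixes f :: "_ \<Rightarrow> _ \<Rightarrow> 'x::ab_group_add" and g :: "'x \<Rightarrow> 'y::ab_group_add"
  assumes add: "\<And>x y. g (x + y) = g x + g y"
  shows "tsum X (\<lambda>x y. g (f x y)) = g (tsum X f)"
proof -
  have "g 0 = 0"
    using add[of 0 0] by simp
  then have "(\<Sum>x\<leftarrow>xs. g (h x)) = g (\<Sum>x\<leftarrow>xs. h x)" for xs and h :: "_ \<Rightarrow> 'x"
    by (induction xs) (simp_all add: add)
  then show ?thesis
    by (simp add: tsum_def case_prod_unfold)
qed

lemma balanced_tsum_left: "balanced E Q f \<Longrightarrow> tsum X (\<lambda>x y. f (g x y) n) \<approx>[E] f (tsum X g) n"
  using balanced_sum_list_left[of E Q f "case_prod g" n "rep X"]
  by (simp add: tsum_def case_prod_unfold)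

lemma balanced_tsum_right: "balanced E Q f \<Longrightarrow> tsum X (\<lambda>x y. f m (g x y)) \<approx>[E] f m (tsum X g)"
  using balanced_sum_list_right[of E Q f m "case_prod g" "rep X"]
  by (simp add: tsum_def case_prod_unfold)

lemma sum_list_map_concat: "(\<Sum>x\<leftarrow>concat xss. f x) = (\<Sum>xs\<leftarrow>xss. \<Sum>x\<leftarrow>xs. f x)"
  by (induction xss) simp_all

lemmas sweedler_simps = tsum_def case_prod_unfold sum_list_map_concat comp_def

text \<open>Each block is an iterated coproduct, its inner tensor depending on its outer variables.
  The exchange brings the block of one factor outside, where coassociativity can be applied to
  it.\<close>

lemma tsum_swap_nested:
  fixes f :: "_ \<Rightarrow> _ \<Rightarrow> _ \<Rightarrow> _ \<Rightarrow> _ \<Rightarrow> _ \<Rightarrow> _ \<Rightarrow> _ \<Rightarrow> 'x::ab_group_add"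
  shows "tsum X (\<lambda>x y. tsum (A x y) (\<lambda>p q. tsum Y (\<lambda>u v. tsum (B u v) (\<lambda>r w. f x y p q u v r w))))
    = tsum Y (\<lambda>u v. tsum (B u v) (\<lambda>r w. tsum X (\<lambda>x y. tsum (A x y) (\<lambda>p q. f x y p q u v r w))))"
proof -
  have "tsum (A x y) (\<lambda>p q. tsum Y (\<lambda>u v. tsum (B u v) (g p q u v)))
      = tsum Y (\<lambda>u v. tsum (B u v) (\<lambda>r w. tsum (A x y) (\<lambda>p q. g p q u v r w)))"
    for x y and g :: "_ \<Rightarrow> _ \<Rightarrow> _ \<Rightarrow> _ \<Rightarrow> _ \<Rightarrow> _ \<Rightarrow> 'x"
    by (simp only: tsum_swap[of "A x y"])
  then show ?thesis
    by (simp only: tsum_swap[of X])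
qed


section \<open>The antipode is anti-multiplicative\<close>

context left_bialgebroid
begin

lemma balanced_balL_iff:
  "balanced E (balL s t) f \<longleftrightarrow>
    (\<forall>x x' y. f (x + x') y \<approx>[E] f x y + f x' y) \<and>
    (\<forall>x y y'. f x (y + y') \<approx>[E] f x y + f x y') \<and>
    (\<forall>x l y. f (t l * x) y \<approx>[E] f x (s l * y))"
  by (simp add: balL_def balanced_balance_iff)

lemma s_one [simp]: "s 1 = 1" and s_mult: "s (l * l') = s l * s l'" and s_add: "s (l + l') = s l + s l'"
  using s_map by (simp_all add: algebra_map_def k_linear_def)

lemma t_one [simp]: "t 1 = 1"
  using t_map by (simp add: op_algebra_map_def)

lemma tsum_\<gamma>_mult:
  assumes "balanced E (balL s t) f"
  shows "tsum (\<gamma> (h * h')) f \<approx>[E] tsum (\<gamma> h) (\<lambda>x y. tsum (\<gamma> h') (\<lambda>x' y'. f (x * x') (y * y')))"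
  unfolding \<gamma>_mult by (rule span_cong_trans[OF tsum_tens[OF assms]]) (simp add: sweedler_simps)

lemma tsum_takeuchi:
  assumes "balanced E (balL s t) f"
  shows "tsum (\<gamma> h) (\<lambda>x y. f (x * t l) y) \<approx>[E] tsum (\<gamma> h) (\<lambda>x y. f x (y * s l))"
  using tens_eval[OF assms takeuchi] by (simp add: sweedler_simps)

end

context right_bialgebroid
begin

lemma balanced_balR_iff:
  "balanced E (balR s t) f \<longleftrightarrow>
    (\<forall>x x' y. f (x + x') y \<approx>[E] f x y + f x' y) \<and>
    (\<forall>x y y'. f x (y + y') \<approx>[E] f x y + f x y') \<and>
    (\<forall>x r y. f (x * s r) y \<approx>[E] f x (y * t r))"
  by (simp add: balR_def balanced_balance_iff)

lemma s_one [simp]: "s 1 = 1" and s_mult: "s (r * r') = s r * s r'" and s_add: "s (r + r') = s r + s r'"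
  using s_map by (simp_all add: algebra_map_def k_linear_def)

lemma t_one [simp]: "t 1 = 1"
  using t_map by (simp add: op_algebra_map_def)

lemma tsum_\<gamma>_s:
  assumes "balanced E (balR s t) f"
  shows "tsum (\<gamma> (h * s r)) f \<approx>[E] tsum (\<gamma> h) (\<lambda>x y. f x (y * s r))"
  unfolding \<gamma>_s by (rule span_cong_trans[OF tsum_tens[OF assms]]) (simp add: sweedler_simps)

lemma tsum_takeuchi:
  assumes "balanced E (balR s t) f"
  shows "tsum (\<gamma> h) (\<lambda>x y. f (s r * x) y) \<approx>[E] tsum (\<gamma> h) (\<lambda>x y. f x (t r * y))"
  using tens_eval[OF assms takeuchi] by (simp add: sweedler_simps)

end

section \<open>Antipode identities\<close>

context hopf_algebroid
begin

lemma tsum_coassoc_LR: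
  assumes "balanced3 E (balL sL tL) (balR sR tR) f"
  shows "tsum (\<gamma>R h) (\<lambda>x z. tsum (\<gamma>L x) (\<lambda>u v. f u v z)) \<approx>[E] tsum (\<gamma>L h) (\<lambda>u w. tsum (\<gamma>R w) (\<lambda>v z. f u v z))"
  using tens3_eval[OF assms coassoc_LR] by (simp add: sweedler_simps)

lemma S_add: "S (x + y) = S x + S y"
  using S_linear by (simp add: k_linear_def)

lemma S_mult_tL: "S (x * tL l) = sL l * S x"
  and S_tL_mult: "S (tL l * x) = S x * sL l"
  using S_tL[of 1 x l] S_tL[of l x 1] by simp_all

lemma S_mult_tR: "S (x * tR r) = sR r * S x"
  and S_tR_mult: "S (tR r * x) = S x * sR r"
  using S_tR[of 1 x r] S_tR[of r x 1] by simp_all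

lemma balanced_S_left: "balanced {} (balL sL tL) (\<lambda>x y. S x * y)"
  by (simp add: L.balanced_balL_iff S_add S_tL_mult algebra_simps)

lemma balanced_S_right: "balanced {} (balR sR tR) (\<lambda>x y. x * S y)"
  by (simp add: R.balanced_balR_iff S_add S_mult_tR algebra_simps)

lemma tsum_S_left: "tsum (\<gamma>L h) (\<lambda>x y. S x * y) = sR (\<pi>R h)"
  and tsum_S_right: "tsum (\<gamma>R h) (\<lambda>x y. x * S y) = sL (\<pi>L h)"
  by (simp_all add: tsum_def S_left S_right)

lemma S_one: "S 1 = 1"
  using tsum_tens[OF balanced_S_left, of "[(1, 1)]"] tsum_S_left[of 1]
  by (simp add: L.\<gamma>_one[symmetric] R.\<pi>_one)

text \<open>The inner sum collapses to \<open>sL (\<pi>L v)\<close>, and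
  \<open>sL (\<pi>L v) * S y = S (y * tL (\<pi>L v))\<close>. As \<open>tL (\<pi>L v)\<close> has
  the form \<open>sR r\<close>, it is absorbed into the coproduct of \<open>u * sR r\<close>. The
  right antipode axiom and \<open>\<pi>L (u * tL (\<pi>L v)) = \<pi>L (u * v)\<close>
  finish.\<close>

lemma sL_\<pi>L_mult:
  "tsum (\<gamma>R u) (\<lambda>x y. tsum (\<gamma>R v) (\<lambda>x' y'. x * x' * S y' * S y)) = sL (\<pi>L (u * v))"
proof -
  define r where "r = \<pi>R (tL (\<pi>L v))"
  have r: "sR r = tL (\<pi>L v)"
    by (simp add: r_def sR_\<pi>R_tL)
  have "tsum (\<gamma>R v) (\<lambda>x' y'. x * x' * S y' * S y) = x * S (y * sR r)" for x y
    using tsum_mult_left[of "\<gamma>R v" x "\<lambda>x' y'. x' * S y' * S y"]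
      tsum_mult_right[of "\<gamma>R v" "\<lambda>x' y'. x' * S y'" "S y"]
    by (simp add: tsum_S_right r S_mult_tL mult.assoc)
  then show ?thesis
    using R.tsum_\<gamma>_s[OF balanced_S_right, of u r] by (simp add: tsum_S_right r L.\<pi>_mult_t)
qed

lemma sR_\<pi>R_mult:
  "tsum (\<gamma>L u) (\<lambda>x y. tsum (\<gamma>L v) (\<lambda>x' y'. S (x * x') * y * y')) = sR (\<pi>R (u * v))"
  using L.tsum_\<gamma>_mult[OF balanced_S_left, of u v] by (simp add: tsum_S_left mult.assoc)

text \<open>Apply \<open>S\<close> to the right counit axiom of the left bialgebroid.\<close>

lemma tsum_S_\<pi>L: "tsum (\<gamma>L h) (\<lambda>x y. S x * sL (\<pi>L y)) = S h"
proof -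
  have "tsum (\<gamma>L h) (\<lambda>x y. S (tL (\<pi>L y) * x)) = S (tsum (\<gamma>L h) (\<lambda>x y. tL (\<pi>L y) * x))"
    by (rule tsum_additive) (rule S_add)
  then show ?thesis
    using L.counit_right[of h] by (simp add: S_tL_mult tsum_def)
qed

text \<open>Without \<open>sR r\<close> this is \<open>S\<close> applied to the left counit axiom of
  the right bialgebroid. The Takeuchi property trades \<open>sR r\<close> on the first leg for
  \<open>tR r\<close> on the second, and \<open>S\<close> turns the latter into a right factor
  \<open>sR r\<close>.\<close>

lemma tsum_S_\<pi>R: "tsum (\<gamma>R h) (\<lambda>x y. sR (\<pi>R (sR r * x)) * S y) = S h * sR r"
proof -
  have bal: "balanced {} (balR sR tR) (\<lambda>x y. sR (\<pi>R x) * S y)"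
    by (simp add: R.balanced_balR_iff S_add S_mult_tR R.\<pi>_add R.\<pi>_s R.s_add R.s_mult algebra_simps)
  have "tsum (\<gamma>R h) (\<lambda>x y. S (y * tR (\<pi>R x))) = S (tsum (\<gamma>R h) (\<lambda>x y. y * tR (\<pi>R x)))"
    by (rule tsum_additive) (rule S_add)
  then have "tsum (\<gamma>R h) (\<lambda>x y. sR (\<pi>R x) * S y) = S h"
    using R.counit_left[of h] by (simp add: S_mult_tR tsum_def)
  then show ?thesis
    using R.tsum_takeuchi[OF bal, of h r]
      tsum_mult_right[of "\<gamma>R h" "\<lambda>x y. sR (\<pi>R x) * S y" "sR r"]
    by (simp add: S_tR_mult mult.assoc)
qed

lemma S_mult: "S (h * k) = S k * S h"
proof -
  \<comment> \<open>The summand to be evaluated in two ways: \<open>x, p, q\<close> are the three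
    legs coming from \<open>h\<close>, and \<open>x', p', q'\<close> those coming from
    \<open>k\<close>.\<close>
  define T where "T = (\<lambda>x p q x' p' q'. S (x * x') * p * p' * S q' * S q)"
  have bal: "balanced {} (balL sL tL) (\<lambda>x y. S x * sL (\<pi>L y))"
    by (simp add: L.balanced_balL_iff S_add S_tL_mult L.\<pi>_add L.\<pi>_s L.s_add L.s_mult algebra_simps)
  have T_L: "tsum (\<gamma>R y) (\<lambda>p q. tsum (\<gamma>R y') (\<lambda>p' q'. T x p q x' p' q')) = S (x * x') * sL (\<pi>L (y * y'))"
    for x y x' y'
    unfolding sL_\<pi>L_mult[symmetric] T_def by (simp flip: tsum_mult_left add: mult.assoc)
  have T_R: "tsum (\<gamma>L w) (\<lambda>x p. tsum (\<gamma>L w') (\<lambda>x' p'. T x p q x' p' q')) = sR (\<pi>R (w * w')) * S q' * S q"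
    for w w' q q'
    unfolding sR_\<pi>R_mult[symmetric] T_def by (simp flip: tsum_mult_right)
  \<comment> \<open>\<open>T\<close> itself is not balanced in \<open>x, p, q\<close>; the sum over \<open>k\<close> is, by the Takeuchi property of \<open>\<gamma>\<^sub>R\<close>,
    and symmetrically for \<open>x', p', q'\<close>.\<close>
  have bal_h: "balanced3 {} (balL sL tL) (balR sR tR)
      (\<lambda>x p q. tsum (\<gamma>L k) (\<lambda>x' y'. tsum (\<gamma>R y') (\<lambda>p' q'. T x p q x' p' q')))"
  proof -
    have "tsum (\<gamma>R y') (\<lambda>p' q'. T x (p * sR r) q x' p' q') = tsum (\<gamma>R y') (\<lambda>p' q'. T x p (q * tR r) x' p' q')"
      for x p q x' y' r
    proof -
      have "balanced {} (balR sR tR) (T x p q x')"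
        by (simp add: R.balanced_balR_iff T_def S_add S_mult_tR algebra_simps)
      from R.tsum_takeuchi[OF this, of y' r] show ?thesis
        by (simp add: T_def S_mult_tR S_tR_mult mult.assoc)
    qed
    then show ?thesis
      by (simp add: balanced3_def L.balanced_balL_iff R.balanced_balR_iff)
        (simp add: T_def S_add S_tL_mult S_mult_tR algebra_simps tsum_add)
  qed
  have bal_k: "balanced3 {} (balL sL tL) (balR sR tR)
      (\<lambda>x' p' q'. tsum (\<gamma>R h) (\<lambda>w q. tsum (\<gamma>L w) (\<lambda>x p. T x p q x' p' q')))"
  proof -
    have "tsum (\<gamma>L w) (\<lambda>x p. T x p q (tL l * x') p' q') = tsum (\<gamma>L w) (\<lambda>x p. T x p q x' (sL l * p') q')"
      for w q x' p' q' l
    proof -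
      have "balanced {} (balL sL tL) (\<lambda>x p. T x p q x' p' q')"
        by (simp add: L.balanced_balL_iff T_def S_add S_tL_mult algebra_simps)
      from L.tsum_takeuchi[OF this, of w l] show ?thesis
        by (simp add: T_def mult.assoc)
    qed
    then show ?thesis
      by (simp add: balanced3_def L.balanced_balL_iff R.balanced_balR_iff)
        (simp add: T_def S_add S_mult_tR algebra_simps tsum_add)
  qed
  \<comment> \<open>\<open>tsum_S_\<pi>L\<close> at \<open>h * k\<close>, read backwards, creates
    the counit factor that \<open>T_L\<close> then unfolds into a sum of \<open>T\<close>.\<close>
  have "S (h * k) = tsum (\<gamma>L h) (\<lambda>x y. tsum (\<gamma>L k) (\<lambda>x' y'. S (x * x') * sL (\<pi>L (y * y'))))"
    using L.tsum_\<gamma>_mult[OF bal, of h k] by (simp add: tsum_S_\<pi>L)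
  also have "\<dots> = tsum (\<gamma>L h) (\<lambda>x y. tsum (\<gamma>R y) (\<lambda>p q.
      tsum (\<gamma>L k) (\<lambda>x' y'. tsum (\<gamma>R y') (\<lambda>p' q'. T x p q x' p' q'))))"
    by (simp only: T_L[symmetric] tsum_swap[of "\<gamma>L k"])
  also have "\<dots> = tsum (\<gamma>R h) (\<lambda>w q. tsum (\<gamma>L w) (\<lambda>x p.
      tsum (\<gamma>L k) (\<lambda>x' y'. tsum (\<gamma>R y') (\<lambda>p' q'. T x p q x' p' q'))))"
    using tsum_coassoc_LR[OF bal_h, of h] by simp
  also have "\<dots> = tsum (\<gamma>L k) (\<lambda>x' y'. tsum (\<gamma>R y') (\<lambda>p' q'.
      tsum (\<gamma>R h) (\<lambda>w q. tsum (\<gamma>L w) (\<lambda>x p. T x p q x' p' q'))))"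
    by (rule tsum_swap_nested)
  also have "\<dots> = tsum (\<gamma>R k) (\<lambda>w' q'. tsum (\<gamma>L w') (\<lambda>x' p'.
      tsum (\<gamma>R h) (\<lambda>w q. tsum (\<gamma>L w) (\<lambda>x p. T x p q x' p' q'))))"
    using tsum_coassoc_LR[OF bal_k, of k] by simp
  also have "\<dots> = tsum (\<gamma>R h) (\<lambda>w q. tsum (\<gamma>L w) (\<lambda>x p.
      tsum (\<gamma>R k) (\<lambda>w' q'. tsum (\<gamma>L w') (\<lambda>x' p'. T x p q x' p' q'))))"
    by (rule tsum_swap_nested)
  also have "\<dots> = tsum (\<gamma>R h) (\<lambda>w q. tsum (\<gamma>R k) (\<lambda>w' q'. sR (\<pi>R (w * w')) * S q' * S q))"
    unfolding T_R[symmetric] by (intro arg_cong[of _ _ "tsum (\<gamma>R h)"] ext tsum_swap)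
  \<comment> \<open>Since \<open>\<pi>R (w * w') = \<pi>R (sR (\<pi>R w) * w')\<close>, the sum over
    \<open>k\<close> is \<open>tsum_S_\<pi>R\<close> with \<open>r = \<pi>R w\<close>; the sum over
    \<open>h\<close> is then its case \<open>r = 1\<close>.\<close>
  also have "\<dots> = tsum (\<gamma>R h) (\<lambda>w q. S k * sR (\<pi>R w) * S q)"
    using tsum_S_\<pi>R[of k "\<pi>R w" for w] by (simp add: tsum_mult_right R.\<pi>_mult_s)
  also have "\<dots> = S k * S h"
    using tsum_S_\<pi>R[of h 1] by (simp add: tsum_mult_left mult.assoc)
  finally show ?thesis .
qed

end


section \<open>Comparing the two coactions\<close>

context right_comodule_of_left_bialgebroid
begin

lemma balanced_balML_iff:
  "balanced E (balML s act) f \<longleftrightarrow>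
    (\<forall>x x' y. f (x + x') y \<approx>[E] f x y + f x' y) \<and>
    (\<forall>x y y'. f x (y + y') \<approx>[E] f x y + f x y') \<and>
    (\<forall>x l y. f (act x l) y \<approx>[E] f x (s l * y))"
  by (simp add: balML_def balanced_balance_iff)

lemma tsum_\<tau>_add:
  assumes "balanced E (balML s act) f"
  shows "tsum (\<tau> (m + m')) f \<approx>[E] tsum (\<tau> m) f + tsum (\<tau> m') f"
  unfolding \<tau>_add by (rule span_cong_trans[OF tsum_tens[OF assms]]) (simp add: sweedler_simps)

lemma tsum_\<tau>_act:
  assumes "balanced E (balML s act) f"
  shows "tsum (\<tau> (act m l)) f \<approx>[E] tsum (\<tau> m) (\<lambda>x y. f x (t l * y))"
  unfolding \<tau>_act by (rule span_cong_trans[OF tsum_tens[OF assms]]) (simp add: sweedler_simps)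

lemma tsum_\<tau>_takeuchi:
  assumes "balanced E (balML s act) f"
  shows "tsum (\<tau> m) (\<lambda>x y. f (lactL s \<pi> act \<tau> l x) y) \<approx>[E] tsum (\<tau> m) (\<lambda>x y. f x (y * s l))"
  using tens_eval[OF assms \<tau>_takeuchi] by (simp add: sweedler_simps)

lemma tsum_counit: "tsum (\<tau> m) (\<lambda>x y. act x (\<pi> y)) = m"
  by (simp add: tsum_def \<tau>_counit)

lemma balanced_mult_right: "balanced E (balML s act) f \<Longrightarrow> balanced E (balML s act) (\<lambda>x y. f x (y * c))"
  by (simp add: balanced_balML_iff distrib_right mult.assoc)

lemma balanced_t_mult:
  assumes "balanced E (balML s act) f"
  shows "balanced E (balML s act) (\<lambda>x y. f x (t l * y))"
proof -
  have "t l * (s l' * y) = s l' * (t l * y)" for l' y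
    by (simp add: s_t_commute flip: mult.assoc)
  with assms show ?thesis
    unfolding balanced_balML_iff by (simp add: distrib_left)
qed

end

context right_comodule_of_right_bialgebroid
begin

lemma balanced_balMR_iff:
  "balanced E (balMR t act) f \<longleftrightarrow>
    (\<forall>x x' y. f (x + x') y \<approx>[E] f x y + f x' y) \<and>
    (\<forall>x y y'. f x (y + y') \<approx>[E] f x y + f x y') \<and>
    (\<forall>x r y. f (act x r) y \<approx>[E] f x (y * t r))"
  by (simp add: balMR_def balanced_balance_iff)

lemma tsum_\<tau>_add:
  assumes "balanced E (balMR t act) f"
  shows "tsum (\<tau> (m + m')) f \<approx>[E] tsum (\<tau> m) f + tsum (\<tau> m') f"
  unfolding \<tau>_add by (rule span_cong_trans[OF tsum_tens[OF assms]]) (simp add: sweedler_simps)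

lemma tsum_\<tau>_act:
  assumes "balanced E (balMR t act) f"
  shows "tsum (\<tau> (act m r)) f \<approx>[E] tsum (\<tau> m) (\<lambda>x y. f x (y * s r))"
  unfolding \<tau>_act by (rule span_cong_trans[OF tsum_tens[OF assms]]) (simp add: sweedler_simps)

lemma tsum_\<tau>_takeuchi:
  assumes "balanced E (balMR t act) f"
  shows "tsum (\<tau> m) (\<lambda>x y. f (lactR s \<pi> act \<tau> r x) y) \<approx>[E] tsum (\<tau> m) (\<lambda>x y. f x (t r * y))"
  using tens_eval[OF assms \<tau>_takeuchi] by (simp add: sweedler_simps)

lemma tsum_counit: "tsum (\<tau> m) (\<lambda>x y. act x (\<pi> y)) = m"
  by (simp add: tsum_def \<tau>_counit)

lemma balanced_mult_left: "balanced E (balMR t act) f \<Longrightarrow> balanced E (balMR t act) (\<lambda>x y. f x (c * y))"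
  by (simp add: balanced_balMR_iff distrib_left mult.assoc[symmetric])

lemma balanced_mult_s:
  assumes "balanced E (balMR t act) f"
  shows "balanced E (balMR t act) (\<lambda>x y. f x (y * s r))"
proof -
  have "y * t r' * s r = y * s r * t r'" for r' y
    by (simp add: s_t_commute mult.assoc)
  with assms show ?thesis
    unfolding balanced_balMR_iff by (simp add: distrib_right)
qed

end

section \<open>How each coaction interacts with products and with the action of the other base
  ring\<close>

context hopf_comodule_algebra
begin

lemma tsum_\<tau>_coassoc_LR:
  assumes "balanced3 E (balML sL actL) (balR sR tR) f"
  shows "tsum (\<tau>R a) (\<lambda>x z. tsum (\<tau>L x) (\<lambda>u v. f u v z)) \<approx>[E] tsum (\<tau>L a) (\<lambda>u w. tsum (\<gamma>R w) (\<lambda>v z. f u v z))"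
  using tens3_eval[OF assms \<tau>_coassoc_LR] by (simp add: sweedler_simps)

lemma tsum_\<tau>_coassoc_RL:
  assumes "balanced3 E (balMR tR actR) (balL sL tL) f"
  shows "tsum (\<tau>L a) (\<lambda>x z. tsum (\<tau>R x) (\<lambda>u v. f u v z)) \<approx>[E] tsum (\<tau>R a) (\<lambda>u w. tsum (\<gamma>L w) (\<lambda>v z. f u v z))"
  using tens3_eval[OF assms \<tau>_coassoc_RL] by (simp add: sweedler_simps)

lemma tsum_\<tau>L_mult:
  assumes "balanced E (balML sL actL) f"
  shows "tsum (\<tau>L (a * a')) f \<approx>[E] tsum (\<tau>L a) (\<lambda>x y. tsum (\<tau>L a') (\<lambda>x' y'. f (x * x') (y * y')))"
  unfolding \<tau>L_mult by (rule span_cong_trans[OF tsum_tens[OF assms]]) (simp add: sweedler_simps)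

lemma tsum_\<tau>R_mult:
  assumes "balanced E (balMR tR actR) f"
  shows "tsum (\<tau>R (a * a')) f \<approx>[E] tsum (\<tau>R a) (\<lambda>x y. tsum (\<tau>R a') (\<lambda>x' y'. f (x * x') (y * y')))"
  unfolding \<tau>R_mult by (rule span_cong_trans[OF tsum_tens[OF assms]]) (simp add: sweedler_simps)

lemma actR_eq: "actR a r = a * actR 1 r"
  using R_ring_right[of a 1 r] by simp

lemma lactR_eq: "lactR sR \<pi>R actR \<tau>R r a = actR 1 r * a"
  using R_ring_left[of r 1 a] by (simp add: R_ring_unit)

lemma actL_mult: "actL (a * a') l = actL a l * a'"
  using Lop_ring_right[of "a * a'" l] Lop_ring_right[of a l] by (simp add: mult.assoc)

lemma lactL_mult: "lactL sL \<pi>L actL \<tau>L l a * a' = a * actL a' l"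
  using Lop_ring_right[of a' l] by (simp add: Lop_ring_left mult.assoc)

text \<open>Take \<open>m = 1\<close> and \<open>l' = 1\<close> in the compatibility of the actions;
  the left and right actions of \<open>L\<close> agree on \<open>1\<close>. Together with
  \<open>actR_one_eq\<close> it lets an action of either base ring be rewritten as one of the
  other.\<close>

lemma actL_one_eq: "actL 1 l = actR 1 (\<pi>R (tL l))"
proof -
  have "actL 1 1 = 1" "actR 1 1 = 1"
    using CL.act_module CR.act_module by (simp_all add: right_module_def)
  then show ?thesis
    using actions_L_R[of l 1 1] by (simp add: Lop_ring_left lactR_eq R.\<pi>_one)
qed

lemma actR_one_eq: "actR 1 r = actL 1 (\<pi>L (sR r))"
  using R.\<pi>_s[of 1 r] by (simp add: actL_one_eq tL_\<pi>L_sR R.\<pi>_one)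

text \<open>In an \<open>L^op\<close>-ring, \<open>x (x' \<cdot> l) = (l \<cdot> x) x'\<close>, and
  the Takeuchi property of \<open>\<tau>L\<close> moves the action on \<open>x\<close> to a right
  factor \<open>sL l\<close> of \<open>y\<close>.\<close>

lemma balanced_\<tau>L_mult:
  assumes "balanced E (balML sL actL) f"
  shows "balanced E (balML sL actL) (\<lambda>x' y'. tsum (\<tau>L a) (\<lambda>x y. f (x * x') (y * y')))"
proof -
  note f = assms[unfolded CL.balanced_balML_iff, rule_format]
  have "tsum (\<tau>L a) (\<lambda>x y. f (x * actL x' l) (y * y')) \<approx>[E] tsum (\<tau>L a) (\<lambda>x y. f (x * x') (y * (sL l * y')))"
    for x' y' l
  proof -
    have "balanced E (balML sL actL) (\<lambda>x y. f (x * x') (y * y'))"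
      unfolding CL.balanced_balML_iff distrib_right mult.assoc actL_mult[symmetric]
      using f by simp
    from CL.tsum_\<tau>_takeuchi[OF this, of a l] show ?thesis
      by (simp add: lactL_mult mult.assoc)
  qed
  then show ?thesis
    unfolding CL.balanced_balML_iff distrib_left tsum_add[symmetric]
    using f by (auto intro!: tsum_cong)
qed

lemma balanced_\<tau>R_mult:
  assumes "balanced E (balMR tR actR) f"
  shows "balanced E (balMR tR actR) (\<lambda>x y. tsum (\<tau>R a) (\<lambda>x' y'. f (x * x') (y * y')))"
proof -
  note f = assms[unfolded CR.balanced_balMR_iff, rule_format]
  have "tsum (\<tau>R a) (\<lambda>x' y'. f (actR x r * x') (y * y')) \<approx>[E] tsum (\<tau>R a) (\<lambda>x' y'. f (x * x') (y * tR r * y'))"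
    for x y r
  proof -
    have "balanced E (balMR tR actR) (\<lambda>x' y'. f (x * x') (y * y'))"
      unfolding CR.balanced_balMR_iff distrib_left R_ring_right[symmetric] mult.assoc[symmetric]
      using f by simp
    from CR.tsum_\<tau>_takeuchi[OF this, of a r] show ?thesis
      by (simp add: R_ring_balanced mult.assoc)
  qed
  then show ?thesis
    unfolding CR.balanced_balMR_iff distrib_right tsum_add[symmetric]
    using f by (auto intro!: tsum_cong)
qed

text \<open>Write \<open>a \<cdot> r = a (1 \<cdot> l)\<close> with
  \<open>l = \<pi>L (sR r)\<close>. The coaction sends \<open>1 \<cdot> l\<close> to
  \<open>1 \<otimes> tL l\<close>, and \<open>tL l = sR r\<close>. The next lemma is the mirror
  image, with the unit factor on the left.\<close>

lemma tsum_\<tau>L_actR: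
  assumes f: "balanced E (balML sL actL) f"
  shows "tsum (\<tau>L (actR a r)) f \<approx>[E] tsum (\<tau>L a) (\<lambda>x y. f x (y * sR r))"
proof -
  define l where "l = \<pi>L (sR r)"
  let ?g = "\<lambda>x' y'. tsum (\<tau>L a) (\<lambda>x y. f (x * x') (y * y'))"
  note g = balanced_\<tau>L_mult[OF f, of a]
  have "tsum (\<tau>L (a * actL 1 l)) f \<approx>[E] tsum (\<tau>L (actL 1 l)) ?g"
    using tsum_\<tau>L_mult[OF f, of a "actL 1 l"] by (simp only: tsum_swap[of "\<tau>L a"])
  also have "\<dots> \<approx>[E] tsum (\<tau>L 1) (\<lambda>x' y'. ?g x' (tL l * y'))"
    by (rule CL.tsum_\<tau>_act[OF g])
  also have "\<dots> \<approx>[E] ?g 1 (tL l * 1)"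
    unfolding \<tau>L_one
    by (rule span_cong_trans[OF tsum_tens[OF CL.balanced_t_mult[OF g]]]) simp
  finally show ?thesis
    using actR_eq[of a r] by (simp add: actR_one_eq l_def tL_\<pi>L_sR)
qed

lemma tsum_\<tau>R_actL:
  assumes f: "balanced E (balMR tR actR) f"
  shows "tsum (\<tau>R (actL a l)) f \<approx>[E] tsum (\<tau>R a) (\<lambda>x y. f x (tL l * y))"
proof -
  define r where "r = \<pi>R (tL l)"
  let ?g = "\<lambda>x y. tsum (\<tau>R a) (\<lambda>x' y'. f (x * x') (y * y'))"
  note g = balanced_\<tau>R_mult[OF f, of a]
  have "tsum (\<tau>R (actR 1 r * a)) f \<approx>[E] tsum (\<tau>R (actR 1 r)) ?g"
    by (rule tsum_\<tau>R_mult[OF f])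
  also have "\<dots> \<approx>[E] tsum (\<tau>R 1) (\<lambda>x' y'. ?g x' (y' * sR r))"
    by (rule CR.tsum_\<tau>_act[OF g])
  also have "\<dots> \<approx>[E] ?g 1 (1 * sR r)"
    unfolding \<tau>R_one
    by (rule span_cong_trans[OF tsum_tens[OF CR.balanced_mult_s[OF g]]]) simp
  finally show ?thesis
    using Lop_ring_right[of a l] by (simp add: actL_one_eq r_def sR_\<pi>R_tL)
qed

section \<open>The comparison maps between \<open>A \<otimes>\<^sub>R H\<close> and
  \<open>A \<otimes>\<^sub>L H\<close>\<close>

definition to_L :: "('a, 'h) tensor \<Rightarrow> ('a, 'h) tensor"
  where "to_L X = tens (balML sL actL) [(x, y * S h). (a, h) \<leftarrow> rep X, (x, y) \<leftarrow> rep (\<tau>L a)]"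

definition to_R :: "('a, 'h) tensor \<Rightarrow> ('a, 'h) tensor"
  where "to_R X = tens (balMR tR actR) [(x, inv S h * y). (a, h) \<leftarrow> rep X, (x, y) \<leftarrow> rep (\<tau>R a)]"

lemma to_L_in: "to_L X \<in> tensor_product (balML sL actL)"
  and to_R_in: "to_R X \<in> tensor_product (balMR tR actR)"
  by (simp_all add: to_L_def to_R_def)

lemma tsum_to_L:
  assumes "balanced E (balML sL actL) f"
  shows "tsum (to_L X) f \<approx>[E] tsum X (\<lambda>a h. tsum (\<tau>L a) (\<lambda>x y. f x (y * S h)))"
  unfolding to_L_def by (rule span_cong_trans[OF tsum_tens[OF assms]]) (simp add: sweedler_simps)

lemma tsum_to_R:
  assumes "balanced E (balMR tR actR) f"
  shows "tsum (to_R X) f \<approx>[E] tsum X (\<lambda>a h. tsum (\<tau>R a) (\<lambda>x y. f x (inv S h * y)))"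
  unfolding to_R_def by (rule span_cong_trans[OF tsum_tens[OF assms]]) (simp add: sweedler_simps)

lemma tsum_can_R:
  assumes "balanced E (balMR tR actR) f"
  shows "tsum (can_R tR actR \<tau>R X) f \<approx>[E] tsum X (\<lambda>a a'. tsum (\<tau>R a') (\<lambda>x y. f (a * x) y))"
  unfolding can_R_def by (rule span_cong_trans[OF tsum_tens[OF assms]]) (simp add: sweedler_simps)

lemma tsum_can_L:
  assumes "balanced E (balML sL actL) f"
  shows "tsum (can_L sL actL \<tau>L X) f \<approx>[E] tsum X (\<lambda>a a'. tsum (\<tau>L a) (\<lambda>x y. f (x * a') y))"
  unfolding can_L_def by (rule span_cong_trans[OF tsum_tens[OF assms]]) (simp add: sweedler_simps)

text \<open>Well-definedness of \<open>to_L\<close>: acting by \<open>r\<close> on \<open>a\<close>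
  puts \<open>sR r\<close> to the right of \<open>y\<close>, which matches
  \<open>S (h * tR r) = sR r * S h\<close>.\<close>

lemma balanced_to_L:
  assumes f: "balanced E (balML sL actL) f"
  shows "balanced E (balMR tR actR) (\<lambda>a h. tsum (\<tau>L a) (\<lambda>x y. f x (y * S h)))"
proof -
  note f' = CL.balanced_mult_right[OF f]
  show ?thesis
    unfolding CR.balanced_balMR_iff
    using CL.tsum_\<tau>_add[OF f'] tsum_\<tau>L_actR[OF f'] f
    by (auto simp: S_add S_mult_tR distrib_left mult.assoc CL.balanced_balML_iff simp flip: tsum_add
        intro!: tsum_cong)
qed

text \<open>Mixed coassociativity replaces the second coaction by \<open>\<gamma>R\<close>, the
  right antipode axiom produces \<open>sL (\<pi>L w)\<close>, balance moves this onto
  \<open>u\<close>, and the counit removes it. Allowing any balanced \<open>f\<close> and a factor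
  \<open>h\<close> makes the lemma serve for the canonical maps, the inverse and the
  coinvariants.\<close>

lemma tsum_\<tau>_S:
  assumes f: "balanced E (balML sL actL) f"
  shows "tsum (\<tau>R a) (\<lambda>x y. tsum (\<tau>L x) (\<lambda>u v. f u (v * S y * h))) \<approx>[E] f a h"
proof -
  have "balanced3 E (balML sL actL) (balR sR tR) (\<lambda>u v y. f u (v * S y * h))"
    using f by (simp add: balanced3_def CL.balanced_balML_iff R.balanced_balR_iff S_add S_mult_tR distrib_left distrib_right mult.assoc)
  from tsum_\<tau>_coassoc_LR[OF this]
  have "tsum (\<tau>R a) (\<lambda>x y. tsum (\<tau>L x) (\<lambda>u v. f u (v * S y * h)))
      \<approx>[E] tsum (\<tau>L a) (\<lambda>u w. tsum (\<gamma>R w) (\<lambda>v y. f u (v * S y * h)))" .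
  also have "\<dots> \<approx>[E] tsum (\<tau>L a) (\<lambda>u w. f (actL u (\<pi>L w)) h)"
  proof (rule tsum_cong)
    fix u w
    have "tsum (\<gamma>R w) (\<lambda>v y. f u (v * S y * h)) \<approx>[E] f u (tsum (\<gamma>R w) (\<lambda>v y. v * S y * h))"
      by (rule balanced_tsum_right[OF f])
    also have "\<dots> = f u (sL (\<pi>L w) * h)"
      by (simp add: tsum_mult_right tsum_S_right)
    also have "\<dots> \<approx>[E] f (actL u (\<pi>L w)) h"
      using f by (simp add: CL.balanced_balML_iff span_cong_sym)
    finally show "tsum (\<gamma>R w) (\<lambda>v y. f u (v * S y * h)) \<approx>[E] f (actL u (\<pi>L w)) h" .
  qed
  also have "\<dots> \<approx>[E] f a h"
    using balanced_tsum_left[OF f, of "\<tau>L a" "\<lambda>u w. actL u (\<pi>L w)"] by (simp add: CL.tsum_counit)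
  finally show ?thesis .
qed

text \<open>Multiplicativity of \<open>\<tau>L\<close> separates the coaction of \<open>a\<close>
  from that of \<open>x\<close>; the latter cancels against \<open>S y\<close> by
  \<open>tsum_\<tau>_S\<close>.\<close>

lemma to_L_can_R: "to_L (can_R tR actR \<tau>R X) = can_L sL actL \<tau>L X"
proof (rule tensor_eqI)
  show "to_L (can_R tR actR \<tau>R X) \<in> tensor_product (balML sL actL)"
    "can_L sL actL \<tau>L X \<in> tensor_product (balML sL actL)"
    by (simp_all add: to_L_in can_L_def)
  let ?E = "tensor_relators (balML sL actL)" and ?f = "\<lambda>x y. frag_of (x, y)"
  note f = balanced_frag_of[of "balML sL actL"]
  have "tsum (to_L (can_R tR actR \<tau>R X)) ?f
      \<approx>[?E] tsum (can_R tR actR \<tau>R X) (\<lambda>a h. tsum (\<tau>L a) (\<lambda>x y. ?f x (y * S h)))"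
    by (rule tsum_to_L[OF f])
  also have "\<dots> \<approx>[?E] tsum X (\<lambda>a a'. tsum (\<tau>R a') (\<lambda>x y. tsum (\<tau>L (a * x)) (\<lambda>u v. ?f u (v * S y))))"
    by (rule tsum_can_R[OF balanced_to_L[OF f]])
  \<comment> \<open>The factor \<open>1\<close> fits the shape of \<open>tsum_\<tau>_S\<close> with
    \<open>h = 1\<close>, its balanced map being multiplication by the coaction of
    \<open>a\<close>.\<close>
  also have "\<dots> \<approx>[?E] tsum X (\<lambda>a a'. tsum (\<tau>R a') (\<lambda>x y.
      tsum (\<tau>L x) (\<lambda>u v. tsum (\<tau>L a) (\<lambda>p q. ?f (p * u) (q * (v * S y * 1))))))"
  proof (intro tsum_cong)
    fix a a' x y
    show "tsum (\<tau>L (a * x)) (\<lambda>u v. ?f u (v * S y))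
        \<approx>[?E] tsum (\<tau>L x) (\<lambda>u v. tsum (\<tau>L a) (\<lambda>p q. ?f (p * u) (q * (v * S y * 1))))"
      using tsum_\<tau>L_mult[OF CL.balanced_mult_right[OF f], of a x "S y"]
      by (subst tsum_swap) (simp add: mult.assoc)
  qed
  also have "\<dots> \<approx>[?E] tsum X (\<lambda>a a'. tsum (\<tau>L a) (\<lambda>p q. ?f (p * a') (q * 1)))"
    by (intro tsum_cong tsum_\<tau>_S[OF balanced_\<tau>L_mult[OF f]])
  also have "\<dots> \<approx>[?E] tsum (can_L sL actL \<tau>L X) ?f"
    using tsum_can_L[OF f] by (simp add: span_cong_sym)
  finally show "tsum (to_L (can_R tR actR \<tau>R X)) ?f \<approx>[?E] tsum (can_L sL actL \<tau>L X) ?f" .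
qed

section \<open>Bijectivity of the comparison map when the antipode is bijective\<close>

context
  assumes S: "bij S"
begin

lemma inv_S_S: "inv S (S h) = h" and S_inv_S: "S (inv S h) = h"
  using S by (simp_all add: bij_is_inj bij_is_surj surj_f_inv_f)

lemma inv_S_add: "inv S (x + y) = inv S x + inv S y"
  by (metis S_add S_inv_S inv_S_S)

lemma inv_S_mult: "inv S (x * y) = inv S y * inv S x"
  by (metis S_mult S_inv_S inv_S_S)

lemma inv_S_sL: "inv S (sL l) = tL l" and inv_S_sR: "inv S (sR r) = tR r"
  using S_mult_tL[of 1 l] S_mult_tR[of 1 r] by (metis S_one inv_S_S mult_1 mult_1_right)+

lemma balanced_to_R:
  assumes f: "balanced E (balMR tR actR) f"
  shows "balanced E (balML sL actL) (\<lambda>a h. tsum (\<tau>R a) (\<lambda>x y. f x (inv S h * y)))"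
proof -
  note f' = CR.balanced_mult_left[OF f]
  show ?thesis
    unfolding CL.balanced_balML_iff
    using CR.tsum_\<tau>_add[OF f'] tsum_\<tau>R_actL[OF f'] f
    by (auto simp: inv_S_add inv_S_mult inv_S_sL distrib_right mult.assoc CR.balanced_balMR_iff simp flip: tsum_add
        intro!: tsum_cong)
qed

text \<open>Apply \<open>inv S\<close>, which reverses products, to the left antipode axiom.\<close>

lemma tsum_inv_S: "tsum (\<gamma>L h) (\<lambda>x y. inv S y * x) = tR (\<pi>R h)"
proof -
  have "tsum (\<gamma>L h) (\<lambda>x y. inv S (S x * y)) = inv S (tsum (\<gamma>L h) (\<lambda>x y. S x * y))"
    by (rule tsum_additive) (rule inv_S_add)
  then show ?thesis
    by (simp add: inv_S_mult inv_S_S tsum_S_left inv_S_sR)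
qed

text \<open>Mirror image of \<open>tsum_\<tau>_S\<close>: the other mixed coassociativity law brings
  in \<open>\<gamma>L\<close>, and \<open>tsum_inv_S\<close> takes the place of the right antipode
  axiom.\<close>

lemma tsum_\<tau>_inv_S:
  assumes f: "balanced E (balMR tR actR) f"
  shows "tsum (\<tau>L a) (\<lambda>x y. tsum (\<tau>R x) (\<lambda>u v. f u (h * inv S y * v))) \<approx>[E] f a h"
proof -
  have "balanced3 E (balMR tR actR) (balL sL tL) (\<lambda>u v y. f u (h * inv S y * v))"
    using f by (simp add: balanced3_def CR.balanced_balMR_iff L.balanced_balL_iff inv_S_add inv_S_mult inv_S_sL distrib_left distrib_right mult.assoc[symmetric])
  from tsum_\<tau>_coassoc_RL[OF this]
  have "tsum (\<tau>L a) (\<lambda>x y. tsum (\<tau>R x) (\<lambda>u v. f u (h * inv S y * v)))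
      \<approx>[E] tsum (\<tau>R a) (\<lambda>u w. tsum (\<gamma>L w) (\<lambda>v y. f u (h * inv S y * v)))" .
  also have "\<dots> \<approx>[E] tsum (\<tau>R a) (\<lambda>u w. f (actR u (\<pi>R w)) h)"
  proof (rule tsum_cong)
    fix u w
    have "tsum (\<gamma>L w) (\<lambda>v y. f u (h * inv S y * v)) \<approx>[E] f u (tsum (\<gamma>L w) (\<lambda>v y. h * inv S y * v))"
      by (rule balanced_tsum_right[OF f])
    also have "\<dots> = f u (h * tR (\<pi>R w))"
      by (simp add: tsum_mult_left tsum_inv_S mult.assoc)
    also have "\<dots> \<approx>[E] f (actR u (\<pi>R w)) h"
      using f by (simp add: CR.balanced_balMR_iff span_cong_sym)
    finally show "tsum (\<gamma>L w) (\<lambda>v y. f u (h * inv S y * v)) \<approx>[E] f (actR u (\<pi>R w)) h" .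
  qed
  also have "\<dots> \<approx>[E] f a h"
    using balanced_tsum_left[OF f, of "\<tau>R a" "\<lambda>u w. actR u (\<pi>R w)"] by (simp add: CR.tsum_counit)
  finally show ?thesis .
qed

text \<open>By anti-multiplicativity \<open>S (inv S h * y) = S y * h\<close>, which is the shape
  cancelled by \<open>tsum_\<tau>_S\<close>.\<close>

lemma to_L_to_R:
  assumes "X \<in> tensor_product (balML sL actL)"
  shows "to_L (to_R X) = X"
proof (rule tensor_eqI)
  show "to_L (to_R X) \<in> tensor_product (balML sL actL)" "X \<in> tensor_product (balML sL actL)"
    using assms by (simp_all add: to_L_in)
  let ?E = "tensor_relators (balML sL actL)" and ?f = "\<lambda>x y. frag_of (x, y)"
  note f = balanced_frag_of[of "balML sL actL"]
  have "tsum (to_L (to_R X)) ?f \<approx>[?E] tsum (to_R X) (\<lambda>a h. tsum (\<tau>L a) (\<lambda>x y. ?f x (y * S h)))"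
    by (rule tsum_to_L[OF f])
  also have "\<dots> \<approx>[?E] tsum X (\<lambda>a h. tsum (\<tau>R a) (\<lambda>x y. tsum (\<tau>L x) (\<lambda>u v. ?f u (v * S (inv S h * y)))))"
    by (rule tsum_to_R[OF balanced_to_L[OF f]])
  also have "\<dots> = tsum X (\<lambda>a h. tsum (\<tau>R a) (\<lambda>x y. tsum (\<tau>L x) (\<lambda>u v. ?f u (v * S y * h))))"
    by (simp add: S_mult S_inv_S mult.assoc)
  also have "\<dots> \<approx>[?E] tsum X ?f"
    by (intro tsum_cong tsum_\<tau>_S[OF f])
  finally show "tsum (to_L (to_R X)) ?f \<approx>[?E] tsum X ?f" .
qed

lemma to_R_to_L:
  assumes "X \<in> tensor_product (balMR tR actR)"
  shows "to_R (to_L X) = X"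
proof (rule tensor_eqI)
  show "to_R (to_L X) \<in> tensor_product (balMR tR actR)" "X \<in> tensor_product (balMR tR actR)"
    using assms by (simp_all add: to_R_in)
  let ?E = "tensor_relators (balMR tR actR)" and ?f = "\<lambda>x y. frag_of (x, y)"
  note f = balanced_frag_of[of "balMR tR actR"]
  have "tsum (to_R (to_L X)) ?f \<approx>[?E] tsum (to_L X) (\<lambda>a h. tsum (\<tau>R a) (\<lambda>x y. ?f x (inv S h * y)))"
    by (rule tsum_to_R[OF f])
  also have "\<dots> \<approx>[?E] tsum X (\<lambda>a h. tsum (\<tau>L a) (\<lambda>x y. tsum (\<tau>R x) (\<lambda>u v. ?f u (inv S (y * S h) * v))))"
    by (rule tsum_to_L[OF balanced_to_R[OF f]])
  also have "\<dots> = tsum X (\<lambda>a h. tsum (\<tau>L a) (\<lambda>x y. tsum (\<tau>R x) (\<lambda>u v. ?f u (h * inv S y * v))))"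
    by (simp add: inv_S_mult inv_S_S)
  also have "\<dots> \<approx>[?E] tsum X ?f"
    by (intro tsum_cong tsum_\<tau>_inv_S[OF f])
  finally show "tsum (to_R (to_L X)) ?f \<approx>[?E] tsum X ?f" .
qed

lemma bij_betw_to_L: "bij_betw to_L (tensor_product (balMR tR actR)) (tensor_product (balML sL actL))"
  by (rule bij_betw_byWitness[where f' = to_R]) (auto simp: to_L_to_R to_R_to_L to_L_in to_R_in)

lemma coinvariants_eq: "coinvariants_R tR actR \<tau>R = coinvariants_L sL actL \<tau>L"
proof -
  let ?E = "tensor_relators (balML sL actL)" and ?f = "\<lambda>x y. frag_of (x, y)"
  note f = balanced_frag_of[of "balML sL actL"]
  have 1: "to_L (\<tau>R a) = tens (balML sL actL) [(a, 1)]" for a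
  proof (rule tensor_eqI)
    have "tsum (to_L (\<tau>R a)) ?f \<approx>[?E] tsum (\<tau>R a) (\<lambda>x y. tsum (\<tau>L x) (\<lambda>u v. ?f u (v * S y * 1)))"
      using tsum_to_L[OF f] by simp
    also have "\<dots> \<approx>[?E] ?f a 1"
      by (rule tsum_\<tau>_S[OF f])
    also have "\<dots> \<approx>[?E] tsum (tens (balML sL actL) [(a, 1)]) ?f"
      using tsum_tens[OF f, of "[(a, 1)]"] by (simp add: span_cong_sym)
    finally show "tsum (to_L (\<tau>R a)) ?f \<approx>[?E] tsum (tens (balML sL actL) [(a, 1)]) ?f" .
  qed (simp_all add: to_L_in)
  have 2: "to_L (tens (balMR tR actR) [(a, 1)]) = \<tau>L a" for a
  proof (rule tensor_eqI)
    have "tsum (to_L (tens (balMR tR actR) [(a, 1)])) ?f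
        \<approx>[?E] tsum (tens (balMR tR actR) [(a, 1)]) (\<lambda>a h. tsum (\<tau>L a) (\<lambda>x y. ?f x (y * S h)))"
      by (rule tsum_to_L[OF f])
    also have "\<dots> \<approx>[?E] tsum (\<tau>L a) ?f"
      using tsum_tens[OF balanced_to_L[OF f], of "[(a, 1)]"] by (simp add: S_one)
    finally show "tsum (to_L (tens (balMR tR actR) [(a, 1)])) ?f \<approx>[?E] tsum (\<tau>L a) ?f" .
  qed (simp_all add: to_L_in CL.\<tau>_in)
  have "\<tau>R a = tens (balMR tR actR) [(a, 1)] \<longleftrightarrow> to_L (\<tau>R a) = to_L (tens (balMR tR actR) [(a, 1)])" for a
    using bij_betw_imp_inj_on[OF bij_betw_to_L] by (simp add: inj_on_eq_iff CR.\<tau>_in)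
  then show ?thesis
    unfolding coinvariants_R_def coinvariants_L_def 1 2 by auto
qed

end

end

section \<open>Transfer of injectivity and surjectivity along the comparison map\<close>

theorem lemma3p3:
  fixes kH :: "'k::{comm_ring,monoid_mult} \<Rightarrow> 'h::{ring,monoid_mult} \<Rightarrow> 'h"
    and kL :: "'k \<Rightarrow> 'l::{ring,monoid_mult} \<Rightarrow> 'l"
    and kR :: "'k \<Rightarrow> 'r::{ring,monoid_mult} \<Rightarrow> 'r"
    and kA :: "'k \<Rightarrow> 'a::{ring,monoid_mult} \<Rightarrow> 'a"
    and sL tL :: "'l \<Rightarrow> 'h" and \<gamma>L :: "'h \<Rightarrow> ('h, 'h) tensor" and \<pi>L :: "'h \<Rightarrow> 'l"
    and sR tR :: "'r \<Rightarrow> 'h" and \<gamma>R :: "'h \<Rightarrow> ('h, 'h) tensor" and \<pi>R :: "'h \<Rightarrow> 'r"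
    and S :: "'h \<Rightarrow> 'h"
    and actL :: "'a \<Rightarrow> 'l \<Rightarrow> 'a" and \<tau>L :: "'a \<Rightarrow> ('a, 'h) tensor"
    and actR :: "'a \<Rightarrow> 'r \<Rightarrow> 'a" and \<tau>R :: "'a \<Rightarrow> ('a, 'h) tensor"
  assumes "hopf_algebroid kH kL sL tL \<gamma>L \<pi>L kR sR tR \<gamma>R \<pi>R S"
    and "bij S"
    and "hopf_comodule_algebra kH kL sL tL \<gamma>L \<pi>L kR sR tR \<gamma>R \<pi>R S kA actL \<tau>L actR \<tau>R"
  shows "coinvariants_R tR actR \<tau>R = coinvariants_L sL actL \<tau>L \<and>
    (let B = coinvariants_R tR actR \<tau>R;
         A_B_A = tensor_product (balAA B);
         A_R_H = tensor_product (balMR tR actR);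
         A_L_H = tensor_product (balML sL actL);
         canR = can_R tR actR \<tau>R;
         canL = can_L sL actL \<tau>L
     in (inj_on canR A_B_A \<longleftrightarrow> inj_on canL A_B_A) \<and>
        (canR ` A_B_A = A_R_H \<longleftrightarrow> canL ` A_B_A = A_L_H) \<and>
        (bij_betw canR A_B_A A_R_H \<longleftrightarrow> bij_betw canL A_B_A A_L_H))"
proof -
  interpret hopf_comodule_algebra kH kL sL tL \<gamma>L \<pi>L kR sR tR \<gamma>R \<pi>R S kA actL \<tau>L actR \<tau>R
    by fact
  define B where "B = coinvariants_R tR actR \<tau>R"
  let ?AA = "tensor_product (balAA B)" and ?AR = "tensor_product (balMR tR actR)"
    and ?AL = "tensor_product (balML sL actL)"
  let ?canR = "can_R tR actR \<tau>R" and ?canL = "can_L sL actL \<tau>L"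
  have bij: "bij_betw to_L ?AR ?AL"
    by (rule bij_betw_to_L) fact
  have comp: "?canL ` ?AA = to_L ` ?canR ` ?AA"
    by (auto simp: image_image to_L_can_R)
  have "?canR X \<in> ?AR" for X
    by (simp add: can_R_def)
  \<comment> \<open>The values of \<open>can_R\<close> lie where \<open>to_L\<close> is injective,
    so the two canonical maps identify the same elements.\<close>
  then have sub: "?canR ` ?AA \<subseteq> ?AR" and eq: "?canL X = ?canL Y \<longleftrightarrow> ?canR X = ?canR Y" for X Y
    using bij_betw_imp_inj_on[OF bij] by (auto simp: inj_on_eq_iff simp flip: to_L_can_R)
  have inj: "inj_on ?canR ?AA \<longleftrightarrow> inj_on ?canL ?AA"
    by (simp add: inj_on_def eq)
  have surj: "?canR ` ?AA = ?AR \<longleftrightarrow> ?canL ` ?AA = ?AL"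
    \<comment> \<open>Both sides become images under \<open>to_L\<close> of subsets of its domain,
      where injectivity allows cancelling \<open>to_L\<close>.\<close>
    unfolding comp bij_betw_imp_surj_on[OF bij, symmetric]
    using inj_on_image_eq_iff[OF bij_betw_imp_inj_on[OF bij] sub order_refl] by simp
  show ?thesis
    using coinvariants_eq[OF assms(2)] inj surj by (simp add: Let_def bij_betw_def flip: B_def)
qed

end
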